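(* Let the disturbances $w_t$ be chosen by an adversary from a bounded set $\Omega\subseteq\mathbb{R}^n$, with $\mathsf{ADV}_\infty>0$. For $k \ge 1$, the performance ratio of MPC with $k$ predictions satisfies $$\mathit{PR}^A(\mathsf{MPC}_k) = \frac{\mathsf{MPCA}_k}{\mathsf{ADV}_k} \le \frac{\mathsf{MPCA}_k}{\mathsf{ADV}_\infty} = \frac{\mathsf{MPCA}_k}{\mathsf{MPCA}_\infty} = 1 + O(\|F^k\|^2) = 1 + O(\lambda^{2k}).$$
   Context: System and cost: $x_{t+1} = A x_t + B u_t + w_t$ with $x_t\in\mathbb{R}^n$, $u_t\in\mathbb{R}^d$, given $x_0$, and for horizon $T\ge1$ the cost is $J = \sum_{t=0}^{T-1} (x_t^\top Q x_t + u_t^\top R u_t) + x_T^\top Q_f x_T$. Standing assumptions: $Q,Q_f\succeq 0$, $R\succ 0$ (symmetric); $(A,B)$ is stabilizable, i.e. there is $K_0$ with $\rho(A-BK_0)<1$ ($\rho$ = spectral radius); $(A,Q)$ is detectable, i.e. $(A^\top,Q)$ is stabilizable. $P$ is the (unique positive semidefinite) solution of $P = Q + A^\top P A - A^\top P B(R + B^\top P B)^{-1} B^\top PA$; $F=A-B(R+B^\top PB)^{-1}B^\top PA$, which satisfies $\rho(F)<1$; $\lambda=\frac{1+\rho(F)}2<1$. $\|\cdot\|$ is the spectral norm. Optimal adversarial cost with $k$ (exact) predictions: $$\mathit{ADV}^T_k = \sup_{w_0, \dots, w_{k-1} \in \Omega} \Big( \min_{u_0} \Big( \sup_{w_k \in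 \Omega} \Big( \cdots \min_{u_{T-k-1}} \Big( \sup_{w_{T-1} \in \Omega} \Big( \min_{u_{T-k}, \dots, u_{T-1}} J \Big) \Big) \Big) \Big) \Big).$$ $\mathsf{ADV}_k=\lim_{T\to\infty}\frac1T\mathit{ADV}_k^T$, and $\mathsf{ADV}_\infty=\lim_{T\to\infty}\frac1T\mathit{ADV}_T^T$ (offline optimal, all disturbances known in advance). MPC with $k\ge1$ predictions (terminal weight $P$): at each step $t$, given $x_t, w_t,\dots,w_{t+k-1}$, compute $$(u_t,\dots,u_{t+k-1})=\arg\min_{u}\ \sum_{i=t}^{t+k-1}(x_i^\top Qx_i+u_i^\top Ru_i)+x_{t+k}^\top P x_{t+k}\quad\text{s.t. } x_{i+1}=Ax_i+Bu_i+w_i,\ i=t,\dots,t+k-1,$$ and apply only $u_t$ (for horizon $T$, set $w_s=0$ for $s\ge T$). $J^{\mathsf{MPC}_k}(w)$ is the resulting cost. $\mathit{MPCA}_k^T=\sup_{w_0,\dots,w_{T-1}\in\Omega}J^{\mathsf{MPC}_k}(w)$, $\mathsf{MPCA}_k=\lim_{T\to\infty}\frac1T\mathit{MPCA}_k^T$, $\mathsf{MPCA}_\infty=\lim_{T\to\infty}\frac1T\mathit{MPCA}_T^T$. All limits are understood to exist. The performance ratio is $\mathit{PR}^A(\mathsf{MPC}_k)=\mathsf{MPCA}_k/\mathsf{ADV}_k$. Notation: $f(k)=O(g(k))$ means there is $C>0$ (independent of $k$) with $|f(k)|\le C\,g(k)$ for all $k\ge1$. *)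

theory Defs
  imports "HOL-Analysis.Analysis"
begin

text \<open>
  The state space is \<open>real ^ 'n\<close> and the control space \<open>real ^ 'd\<close>. Matrices multiply with
  \<open>**\<close>, and \<open>\<bullet>\<close> is the Euclidean inner product, so that \<open>x \<bullet> (Q *v x)\<close> is the quadratic
  form of \<open>Q\<close> at \<open>x\<close>.
\<close>

section \<open>Matrices\<close>

text \<open>The library operation \<open>^\<close> on \<open>real ^ 'n ^ 'n\<close> is the entrywise power.\<close>

definition matrix_power :: "real ^ 'n ^ 'n \<Rightarrow> nat \<Rightarrow> real ^ 'n ^ 'n" where
  "matrix_power M k = (((**) M) ^^ k) (mat 1)"

definition spectral_norm :: "real ^ 'm ^ 'n \<Rightarrow> real" where
  "spectral_norm M = onorm ((*v) M)"

definition complex_eigenvalues :: "real ^ 'n ^ 'n \<Rightarrow> complex set" where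
  "complex_eigenvalues M =
     {z. \<exists>v. v \<noteq> 0 \<and> (\<chi> i j. complex_of_real (M $ i $ j)) *v v = z *s v}"

definition spectral_radius :: "real ^ 'n ^ 'n \<Rightarrow> real" where
  "spectral_radius M = Max (cmod ` complex_eigenvalues M)"

definition pos_semidef :: "real ^ 'n ^ 'n \<Rightarrow> bool" where
  "pos_semidef M \<longleftrightarrow> transpose M = M \<and> (\<forall>x. x \<bullet> (M *v x) \<ge> 0)"

definition pos_def :: "real ^ 'n ^ 'n \<Rightarrow> bool" where
  "pos_def M \<longleftrightarrow> transpose M = M \<and> (\<forall>x. x \<noteq> 0 \<longrightarrow> x \<bullet> (M *v x) > 0)"

definition stabilizable :: "real ^ 'n ^ 'n \<Rightarrow> real ^ 'd ^ 'n \<Rightarrow> bool" where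
  "stabilizable A B \<longleftrightarrow> (\<exists>K :: real ^ 'n ^ 'd. spectral_radius (A - B ** K) < 1)"

definition detectable :: "real ^ 'n ^ 'n \<Rightarrow> real ^ 'n ^ 'n \<Rightarrow> bool" where
  "detectable A Q \<longleftrightarrow> stabilizable (transpose A) Q"

section \<open>System and cost\<close>

primrec lin_state ::
  "real ^ 'n ^ 'n \<Rightarrow> real ^ 'd ^ 'n \<Rightarrow> real ^ 'n \<Rightarrow> (nat \<Rightarrow> real ^ 'd) \<Rightarrow> (nat \<Rightarrow> real ^ 'n)
     \<Rightarrow> nat \<Rightarrow> real ^ 'n" where
  "lin_state A B x0 u w 0 = x0"
| "lin_state A B x0 u w (Suc t) = A *v lin_state A B x0 u w t + B *v u t + w t"

text \<open>
  Control and disturbance sequences are total functions on \<open>nat\<close>; the cost over horizon \<open>T\<close> only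
  depends on their first \<open>T\<close> entries.
\<close>

definition lq_cost ::
  "real ^ 'n ^ 'n \<Rightarrow> real ^ 'd ^ 'n \<Rightarrow> real ^ 'n ^ 'n \<Rightarrow> real ^ 'd ^ 'd \<Rightarrow> real ^ 'n ^ 'n
     \<Rightarrow> real ^ 'n \<Rightarrow> nat \<Rightarrow> (nat \<Rightarrow> real ^ 'd) \<Rightarrow> (nat \<Rightarrow> real ^ 'n) \<Rightarrow> real" where
  "lq_cost A B Q R Qf x0 T u w =
     (\<Sum>t<T. lin_state A B x0 u w t \<bullet> (Q *v lin_state A B x0 u w t) + u t \<bullet> (R *v u t))
       + lin_state A B x0 u w T \<bullet> (Qf *v lin_state A B x0 u w T)"

section \<open>Optimal adversarial cost\<close>

text \<open>
  \<open>adv_value \<dots> \<Omega> k T m t u w\<close> is the value of the game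
  \<open>min u\<^sub>t sup w\<^sub>t\<^sub>+\<^sub>k min u\<^sub>t\<^sub>+\<^sub>1 \<dots> sup w\<^sub>t\<^sub>+\<^sub>k\<^sub>+\<^sub>m\<^sub>-\<^sub>1 min (u\<^sub>t\<^sub>+\<^sub>m, \<dots>, u\<^sub>T\<^sub>-\<^sub>1) J\<close>
  with \<open>m\<close> alternations left, where \<open>u\<close> records the controls chosen before time \<open>t\<close> and \<open>w\<close> the
  disturbances chosen before time \<open>t + k\<close>. Minima are written as infima.
  For positive semidefinite \<open>Q\<close>, \<open>Qf\<close>, positive definite \<open>R\<close> and bounded nonempty \<open>\<Omega>\<close>, all
  these real infima and suprema are over nonempty sets that are bounded on the relevant side:
  the cost is nonnegative, and for fixed controls it is bounded over disturbances in \<open>\<Omega>\<close>.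
\<close>

primrec adv_value ::
  "real ^ 'n ^ 'n \<Rightarrow> real ^ 'd ^ 'n \<Rightarrow> real ^ 'n ^ 'n \<Rightarrow> real ^ 'd ^ 'd \<Rightarrow> real ^ 'n ^ 'n
     \<Rightarrow> real ^ 'n \<Rightarrow> (real ^ 'n) set \<Rightarrow> nat \<Rightarrow> nat \<Rightarrow> nat \<Rightarrow> nat
     \<Rightarrow> (nat \<Rightarrow> real ^ 'd) \<Rightarrow> (nat \<Rightarrow> real ^ 'n) \<Rightarrow> real" where
  "adv_value A B Q R Qf x0 \<Omega> k T 0 t u w =
     (INF u' \<in> {u'. \<forall>i<t. u' i = u i}. lq_cost A B Q R Qf x0 T u' w)"
| "adv_value A B Q R Qf x0 \<Omega> k T (Suc m) t u w =
     (INF v. SUP z \<in> \<Omega>. adv_value A B Q R Qf x0 \<Omega> k T m (Suc t) (u(t := v)) (w(t + k := z)))"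

text \<open>
  For \<open>k \<ge> T\<close> there are no alternations, and this is the offline optimal adversarial cost. The
  initial control sequence \<open>\<lambda>_. 0\<close> is a dummy: no control has been chosen at time \<open>0\<close>.
\<close>

definition adv_cost ::
  "real ^ 'n ^ 'n \<Rightarrow> real ^ 'd ^ 'n \<Rightarrow> real ^ 'n ^ 'n \<Rightarrow> real ^ 'd ^ 'd \<Rightarrow> real ^ 'n ^ 'n
     \<Rightarrow> real ^ 'n \<Rightarrow> (real ^ 'n) set \<Rightarrow> nat \<Rightarrow> nat \<Rightarrow> real" where
  "adv_cost A B Q R Qf x0 \<Omega> k T =
     (SUP w \<in> {w. \<forall>i<k. w i \<in> \<Omega>}. adv_value A B Q R Qf x0 \<Omega> k T (T - k) 0 (\<lambda>_. 0) w)"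

section \<open>Model predictive control\<close>

text \<open>
  First control of an optimal plan over \<open>k\<close> steps from state \<open>x\<close> with terminal weight \<open>P\<close>, where
  \<open>w i\<close> is the predicted disturbance \<open>i\<close> steps ahead. The first \<open>k\<close> entries of the minimizer are
  unique for positive definite \<open>R\<close>; the remaining entries do not affect the cost.
\<close>

definition mpc_control ::
  "real ^ 'n ^ 'n \<Rightarrow> real ^ 'd ^ 'n \<Rightarrow> real ^ 'n ^ 'n \<Rightarrow> real ^ 'd ^ 'd \<Rightarrow> real ^ 'n ^ 'n
     \<Rightarrow> nat \<Rightarrow> real ^ 'n \<Rightarrow> (nat \<Rightarrow> real ^ 'n) \<Rightarrow> real ^ 'd" where
  "mpc_control A B Q R P k x w = (arg_min (\<lambda>u. lq_cost A B Q R P x k u w) (\<lambda>_. True)) 0"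

primrec mpc_state ::
  "real ^ 'n ^ 'n \<Rightarrow> real ^ 'd ^ 'n \<Rightarrow> real ^ 'n ^ 'n \<Rightarrow> real ^ 'd ^ 'd \<Rightarrow> real ^ 'n ^ 'n
     \<Rightarrow> nat \<Rightarrow> real ^ 'n \<Rightarrow> (nat \<Rightarrow> real ^ 'n) \<Rightarrow> nat \<Rightarrow> real ^ 'n" where
  "mpc_state A B Q R P k x0 w 0 = x0"
| "mpc_state A B Q R P k x0 w (Suc t) =
     A *v mpc_state A B Q R P k x0 w t
       + B *v mpc_control A B Q R P k (mpc_state A B Q R P k x0 w t) (\<lambda>i. w (t + i))
       + w t"

definition mpc_input ::
  "real ^ 'n ^ 'n \<Rightarrow> real ^ 'd ^ 'n \<Rightarrow> real ^ 'n ^ 'n \<Rightarrow> real ^ 'd ^ 'd \<Rightarrow> real ^ 'n ^ 'n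
     \<Rightarrow> nat \<Rightarrow> real ^ 'n \<Rightarrow> (nat \<Rightarrow> real ^ 'n) \<Rightarrow> nat \<Rightarrow> real ^ 'd" where
  "mpc_input A B Q R P k x0 w t =
     mpc_control A B Q R P k (mpc_state A B Q R P k x0 w t) (\<lambda>i. w (t + i))"

text \<open>Disturbances at times \<open>s \<ge> T\<close> are set to \<open>0\<close>. The cost is charged with the terminal
  weight \<open>Qf\<close>, whereas the controller plans with \<open>P\<close>.\<close>

definition mpc_cost ::
  "real ^ 'n ^ 'n \<Rightarrow> real ^ 'd ^ 'n \<Rightarrow> real ^ 'n ^ 'n \<Rightarrow> real ^ 'd ^ 'd \<Rightarrow> real ^ 'n ^ 'n
     \<Rightarrow> real ^ 'n ^ 'n \<Rightarrow> real ^ 'n \<Rightarrow> nat \<Rightarrow> nat \<Rightarrow> (nat \<Rightarrow> real ^ 'n) \<Rightarrow> real" where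
  "mpc_cost A B Q R Qf P x0 k T w =
     (let w' = (\<lambda>s. if s < T then w s else 0)
      in lq_cost A B Q R Qf x0 T (mpc_input A B Q R P k x0 w') w')"

definition mpc_adv_cost ::
  "real ^ 'n ^ 'n \<Rightarrow> real ^ 'd ^ 'n \<Rightarrow> real ^ 'n ^ 'n \<Rightarrow> real ^ 'd ^ 'd \<Rightarrow> real ^ 'n ^ 'n
     \<Rightarrow> real ^ 'n ^ 'n \<Rightarrow> real ^ 'n \<Rightarrow> (real ^ 'n) set \<Rightarrow> nat \<Rightarrow> nat \<Rightarrow> real" where
  "mpc_adv_cost A B Q R Qf P x0 \<Omega> k T =
     (SUP w \<in> {w. \<forall>i<T. w i \<in> \<Omega>}. mpc_cost A B Q R Qf P x0 k T w)"

section \<open>Asymptotic notation\<close>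

text \<open>Unlike the library's Landau symbol, the bound is required for every \<open>k \<ge> 1\<close>, not just
  eventually, and without an absolute value around \<open>g\<close>.\<close>

definition big_O :: "(nat \<Rightarrow> real) \<Rightarrow> (nat \<Rightarrow> real) set" where
  "big_O g = {f. \<exists>C>0. \<forall>k\<ge>1. \<bar>f k\<bar> \<le> C * g k}"

end

theory Submission
  imports Defs "HOL-Computational_Algebra.Fundamental_Theorem_Algebra"
begin

text \<open>
  Completing the square in the Riccati equation writes the cost with terminal weight \<open>P\<close> as the
  offline optimum plus \<open>\<Sum>\<^sub>t d\<^sub>t \<bullet> G d\<^sub>t\<close>, where \<open>G = R + B\<^sup>T P B\<close> and \<open>d\<^sub>t\<close> is the deviation of
  the control from the offline optimal feedback. That feedback is affine with offset linear in
  \<open>\<Sum>\<^sub>i (F\<^sup>T)\<^sup>i P w\<^sub>t\<^sub>+\<^sub>i\<close>, and MPC with \<open>k\<close> predictions truncates this sum after \<open>k\<close> terms, so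
  \<open>d\<^sub>t = O(\<parallel>F\<^sup>k\<parallel>)\<close> and the loss per step is \<open>O(\<parallel>F\<^sup>k\<parallel>\<^sup>2)\<close>. The closed loop is stable, so
  exchanging the terminal weights \<open>P\<close> and \<open>Qf\<close> costs MPC only \<open>O(1)\<close>; for an arbitrary
  competitor the exchange costs at most \<open>\<epsilon> T + O\<^sub>\<epsilon>(1)\<close>, by detectability.
\<close>

section \<open>Eigenvalues and growth of matrix powers\<close>

text \<open>Three points shape the proof. First, powers of a matrix are bounded by a multiple of
  \<open>r^k\<close> only for \<open>r\<close> strictly above the spectral radius, since at the
  radius itself Jordan blocks may add polynomial growth; this is why \<open>lam\<close> lies
  strictly between \<open>spectral_radius F\<close> and 1. Second, MPC with \<open>T\<close>
  predictions is exactly optimal for the terminal weight \<open>P\<close>, while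
  \<open>ADV_inf\<close> charges \<open>Qf\<close>, which may vanish, so a competitor may end in a
  large state for free. The resulting error \<open>\<epsilon> T\<close> survives division by
  \<open>T\<close>; hence \<open>MPCA_inf = ADV_inf\<close> is reached only by choosing
  \<open>\<epsilon>\<close> small against a supposed gap between the two limits. Third, the
  constants must not depend on \<open>k\<close>, so closed-loop bounds are proved for an arbitrary
  bounded feedback offset and cover all lookaheads at once. The absolute value in
  \<open>big_O\<close> is harmless: no controller beats the offline optimum, so
  \<open>MPCA_inf = ADV_inf \<le> MPCA k\<close>, and only an upper bound remains. Suprema and
  infima are real-valued, so every step through the game also needs boundedness.\<close>

definition poly_act :: "complex poly \<Rightarrow> complex ^ 'n ^ 'n \<Rightarrow> complex ^ 'n \<Rightarrow> complex ^ 'n" where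
  "poly_act p M v = fold_coeffs (\<lambda>a y. a *s v + M *v y) p 0"

definition roots_poly :: "complex multiset \<Rightarrow> complex poly" where
  "roots_poly X = (\<Prod>z\<in>#X. [:- z, 1:])"

lemma roots_poly_simps [simp]:
  "roots_poly {#} = 1" "roots_poly (add_mset z X) = [:- z, 1:] * roots_poly X"
  by (simp_all add: roots_poly_def)

lemma poly_act_0 [simp]: "poly_act 0 M v = 0"
  by (simp add: poly_act_def)

text \<open>Horner's rule for the polynomial in \<open>M\<close> applied to \<open>v\<close>. The
  case split is needed because \<open>fold_coeffs\<close> does not process the zero polynomial
  written as \<open>pCons 0 0\<close>.\<close>

lemma poly_act_pCons [simp]: "poly_act (pCons a p) M v = a *s v + M *v poly_act p M v"
  by (cases "p = 0 \<and> a = 0") (auto simp: poly_act_def)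

lemma poly_act_1 [simp]: "poly_act 1 M v = v"
  by (simp add: one_pCons)

lemma poly_act_add: "poly_act (p + q) M v = poly_act p M v + poly_act q M v"
  by (induction p q rule: poly_induct2)
     (simp_all add: matrix_vector_right_distrib vec.scale_left_distrib)

lemma poly_act_smult: "poly_act (smult a p) M v = a *s poly_act p M v"
  by (induction p) (simp_all add: vector_scalar_commute vec.scale_right_distrib)

lemma poly_act_right_add: "poly_act p M (v + w) = poly_act p M v + poly_act p M w"
  by (induction p) (simp_all add: matrix_vector_right_distrib vec.scale_right_distrib)

lemma poly_act_right_scale: "poly_act p M (a *s v) = a *s poly_act p M v"
  by (induction p) (simp_all add: vector_scalar_commute vec.scale_right_distrib mult.commute)

lemma poly_act_right_0 [simp]: "poly_act p M 0 = 0"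
  using poly_act_right_scale[of p M 0 0] by simp

lemma poly_act_right_sum: "poly_act p M (\<Sum>i\<in>I. f i) = (\<Sum>i\<in>I. poly_act p M (f i))"
  by (induction I rule: infinite_finite_induct) (simp_all add: poly_act_right_add)

lemma poly_act_mult: "poly_act (p * q) M v = poly_act p M (poly_act q M v)"
  by (induction p) (simp_all add: poly_act_add poly_act_smult)

lemma poly_act_monom: "poly_act (monom a i) M v = a *s (((*v) M) ^^ i) v"
  by (induction i) (simp_all add: monom_0 monom_Suc vector_scalar_commute)

lemma poly_act_sum: "poly_act (\<Sum>i\<in>I. f i) M v = (\<Sum>i\<in>I. poly_act (f i) M v)"
  by (induction I rule: infinite_finite_induct) (simp_all add: poly_act_add)

lemma poly_act_eigenvector: "M *v v = z *s v \<Longrightarrow> poly_act p M v = poly p z *s v"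
  by (induction p)
     (simp_all add: vector_scalar_commute vec.scale_left_distrib mult.commute)

text \<open>The iterates of \<open>v\<close> up to exponent \<open>CARD('n)\<close> are one more
  than the dimension, so they satisfy a linear relation.\<close>

lemma exists_annihilating_poly:
  fixes M :: "complex ^ 'n ^ 'n"
  shows "\<exists>p. p \<noteq> 0 \<and> poly_act p M v = 0"
proof -
  define f where "f i = (((*v) M) ^^ i) v" for i
  show ?thesis
  proof (cases "inj_on f {..CARD('n)}")
    \<comment> \<open>Dependence is a property of sets, so a repeated iterate has to be treated
      apart, with the difference of two monomials.\<close>
    case False
    then obtain i j where "i \<noteq> j" "f i = f j"
      by (auto simp: inj_on_def)
    then have "monom 1 i + smult (-1) (monom 1 j) \<noteq> (0 :: complex poly)"
      and "poly_act (monom 1 i + smult (-1) (monom 1 j)) M v = 0"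
      by (simp add: monom_eq_iff')
         (simp only: \<open>f i = f j\<close> poly_act_add poly_act_smult poly_act_monom flip: f_def, simp)
    then show ?thesis
      by blast
  next
    case True
    have fin: "finite (f ` {..CARD('n)})"
      by simp
    have "vec.dependent (f ` {..CARD('n)})"
      using vec.independent_card_le_dim[of "f ` {..CARD('n)}" UNIV] card_image[OF True]
      by (auto simp: vec_dim_card simp del: vec.dim_UNIV)
    then obtain u where u: "\<exists>y\<in>f ` {..CARD('n)}. u y \<noteq> 0" "(\<Sum>y\<in>f ` {..CARD('n)}. u y *s y) = 0"
      using vec.dependent_finite[OF fin] by auto
    define p where "p = (\<Sum>i\<le>CARD('n). monom (u (f i)) i)"
    have "coeff p i = u (f i)" if "i \<le> CARD('n)" for i
      using that by (simp add: p_def coeff_sum if_distrib sum.delta cong: if_cong)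
    then have "p \<noteq> 0"
      using u(1) by (metis atMost_iff coeff_0 imageE)
    moreover have "poly_act p M v = (\<Sum>i\<le>CARD('n). u (f i) *s f i)"
      by (simp add: p_def poly_act_sum poly_act_monom f_def)
    then have "poly_act p M v = 0"
      using u(2) by (simp add: sum.reindex[OF True])
    ultimately show ?thesis
      by blast
  qed
qed

lemma exists_annihilating_roots:
  fixes M :: "complex ^ 'n ^ 'n"
  obtains X where "poly_act (roots_poly X) M v = 0"
proof -
  obtain p where p: "p \<noteq> 0" "poly_act p M v = 0"
    using exists_annihilating_poly by blast
  obtain X where "p = smult (lead_coeff p) (roots_poly X)"
    using alg_closed_imp_factorization[OF p(1)] unfolding roots_poly_def by blast
  then have "lead_coeff p *s poly_act (roots_poly X) M v = 0"
    using p(2) poly_act_smult by metis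
  then have "poly_act (roots_poly X) M v = 0"
    using p(1) by simp
  then show ?thesis
    by (rule that)
qed

definition mat_eigenvalues :: "complex ^ 'n ^ 'n \<Rightarrow> complex set" where
  "mat_eigenvalues M = {z. \<exists>v. v \<noteq> 0 \<and> M *v v = z *s v}"

text \<open>The product of annihilators of the basis vectors annihilates every vector, so each
  eigenvalue is among its roots. Finiteness and nonemptiness make the \<open>Max\<close> in
  \<open>spectral_radius\<close> meaningful.\<close>

lemma finite_mat_eigenvalues: "finite (mat_eigenvalues (M :: complex ^ 'n ^ 'n))"
proof -
  obtain p where p: "\<And>i :: 'n. p i \<noteq> 0 \<and> poly_act (p i) M (axis i 1) = 0"
    using choice[of "\<lambda>i p. p \<noteq> 0 \<and> poly_act p M (axis i 1) = 0"] exists_annihilating_poly by blast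
  define q where "q = (\<Prod>i\<in>UNIV. p i)"
  have q0: "q \<noteq> 0"
    using p by (simp add: q_def)
  have "poly_act q M (axis i 1) = 0" for i
  proof -
    have "q = (\<Prod>j\<in>UNIV - {i}. p j) * p i"
      unfolding q_def by (subst prod.remove[of _ i]) (simp_all add: mult.commute)
    then show ?thesis
      using p by (simp add: poly_act_mult)
  qed
  then have q: "poly_act q M v = 0" for v
    by (subst basis_expansion[of v, symmetric]) (simp add: poly_act_right_sum poly_act_right_scale)
  have "mat_eigenvalues M \<subseteq> {z. poly q z = 0}"
  proof (clarsimp simp: mat_eigenvalues_def)
    fix z v
    assume "v \<noteq> 0" "M *v v = z *s v"
    then show "poly q z = 0"
      using q[of v] poly_act_eigenvector[of M v z q] by simp
  qed
  then show ?thesis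
    using poly_roots_finite[OF q0] finite_subset by blast
qed

text \<open>Without eigenvalues each factor \<open>M - z\<close> is injective, so all linear factors
  of an annihilator can be stripped off, which would make a basis vector zero.\<close>

lemma mat_eigenvalues_nonempty: "mat_eigenvalues (M :: complex ^ 'n ^ 'n) \<noteq> {}"
proof
  assume none: "mat_eigenvalues M = {}"
  have "v = 0" if "poly_act (roots_poly X) M v = 0" for X v
    using that
  proof (induction X)
    case (add z X)
    have "M *v poly_act (roots_poly X) M v = z *s poly_act (roots_poly X) M v"
      using add.prems by (simp only: roots_poly_simps poly_act_mult) (simp add: algebra_simps)
    then show ?case
      using none add.IH by (force simp: mat_eigenvalues_def)
  qed simp
  then have "(axis undefined 1 :: complex ^ 'n) = 0"
    by (metis exists_annihilating_roots)
  then show False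
    by (simp add: axis_eq_0_iff)
qed

lemma norm_vector_scalar: "norm (z *s v) = cmod z * norm (v :: complex ^ 'n)"
  by (simp add: norm_vec_def L2_set_def norm_mult power_mult_distrib real_sqrt_mult
      flip: sum_distrib_left)

text \<open>Induction on the roots of an annihilator replaces the Jordan form. A root that is no
  eigenvalue cancels. For an eigenvalue \<open>z\<close> the vector \<open>(M - z) v\<close> has a
  shorter annihilator, and its iterates force a scalar recursion for those of \<open>v\<close>; the
  strict gap between \<open>cmod z\<close> and \<open>r\<close> absorbs the forcing.\<close>

lemma matrix_powers_bound_vector:
  fixes M :: "complex ^ 'n ^ 'n"
  assumes ev: "\<And>z. z \<in> mat_eigenvalues M \<Longrightarrow> cmod z < r"
  shows "\<exists>C. \<forall>k. norm ((((*v) M) ^^ k) v) \<le> C * r ^ k"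
proof -
  have r: "r > 0"
    using mat_eigenvalues_nonempty ev by (metis ex_in_conv norm_ge_zero order_le_less_trans)
  have "\<exists>C. \<forall>k. norm ((((*v) M) ^^ k) v) \<le> C * r ^ k"
    if "poly_act (roots_poly X) M v = 0" for X v
    using that
  proof (induction X arbitrary: v)
    case empty
    have "(((*v) M) ^^ k) 0 = 0" for k
      by (induction k) auto
    then show ?case
      using empty by (intro exI[of _ 0]) simp
  next
    case (add z X)
    show ?case
    proof (cases "z \<in> mat_eigenvalues M")
      case False
      have "M *v poly_act (roots_poly X) M v = z *s poly_act (roots_poly X) M v"
        using add.prems by (simp only: roots_poly_simps poly_act_mult) (simp add: algebra_simps)
      then show ?thesis
        using False add.IH by (auto simp: mat_eigenvalues_def)
    next
      case True
      define u where "u = poly_act [:- z, 1:] M v"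
      have u: "u = M *v v - z *s v"
        by (simp add: u_def)
      have "poly_act (roots_poly X) M u = poly_act (roots_poly X * [:- z, 1:]) M v"
        by (simp only: poly_act_mult u_def)
      then have "poly_act (roots_poly X) M u = 0"
        using add.prems by (simp only: roots_poly_simps mult.commute)
      then obtain C where C: "\<And>k. norm ((((*v) M) ^^ k) u) \<le> C * r ^ k"
        using add.IH by blast
      have step: "(((*v) M) ^^ Suc k) v = z *s (((*v) M) ^^ k) v + (((*v) M) ^^ k) u" for k
        by (induction k) (simp_all add: u matrix_vector_right_distrib vector_scalar_commute)
      \<comment> \<open>The first argument of \<open>max\<close> covers \<open>k = 0\<close>; the
        second gives \<open>cmod z * D + C \<le> r * D\<close>, the induction step.\<close>
      define D where "D = max (norm v) (C / (r - cmod z))"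
      have z: "cmod z < r"
        using True ev by blast
      have D: "C \<le> (r - cmod z) * D"
        using z by (simp add: D_def field_simps max_def)
      have "norm ((((*v) M) ^^ k) v) \<le> D * r ^ k" for k
      proof (induction k)
        case 0
        then show ?case
          by (simp add: D_def)
      next
        case (Suc k)
        have "norm ((((*v) M) ^^ Suc k) v) \<le> cmod z * (D * r ^ k) + C * r ^ k"
          unfolding step
          by (rule norm_triangle_le)
             (intro add_mono C, simp add: norm_vector_scalar Suc mult_left_mono)
        also have "\<dots> \<le> (cmod z * D + (r - cmod z) * D) * r ^ k"
          using D r by (simp add: distrib_right mult_right_mono mult.assoc)
        finally show ?case
          by (simp add: algebra_simps)
      qed
      then show ?thesis
        by blast
    qed
  qed
  then show ?thesis
    by (metis exists_annihilating_roots)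
qed

section \<open>Real matrices through complexification\<close>

lemma complexify_mult:
  "(\<chi> i j. complex_of_real (M $ i $ j)) *v (\<chi> i. complex_of_real (x $ i)) =
     (\<chi> i. complex_of_real ((M *v x) $ i))"
  by (simp add: matrix_vector_mult_def vec_eq_iff)

lemma complex_eigenvalues_alt:
  "complex_eigenvalues M = mat_eigenvalues (\<chi> i j. complex_of_real (M $ i $ j))"
  by (simp add: complex_eigenvalues_def mat_eigenvalues_def)

lemma complex_eigenvalues_finite: "finite (complex_eigenvalues M)"
  and complex_eigenvalues_nonempty: "complex_eigenvalues M \<noteq> {}"
  by (simp_all add: complex_eigenvalues_alt finite_mat_eigenvalues mat_eigenvalues_nonempty)

lemma spectral_radius_less_iff:
  "spectral_radius M < r \<longleftrightarrow> (\<forall>z\<in>complex_eigenvalues M. cmod z < r)"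
  by (simp add: spectral_radius_def complex_eigenvalues_finite complex_eigenvalues_nonempty)

lemma spectral_radius_nonneg: "0 \<le> spectral_radius M"
  using spectral_radius_less_iff[of M 0] complex_eigenvalues_nonempty[of M] by force

text \<open>Eigenvalues are the \<open>z\<close> for which \<open>M - z\<close> is singular, and the
  determinant ignores transposition. Both detectability and the powers of \<open>transpose F\<close>
  in the feedback offset rely on this.\<close>

lemma mat_eigenvalues_transpose: "mat_eigenvalues (transpose M) = mat_eigenvalues M"
proof -
  have "z \<in> mat_eigenvalues M \<longleftrightarrow> \<not> invertible (M - mat z)" for z and M :: "complex ^ 'n ^ 'n"
  proof -
    have "(M - mat z) *v v = M *v v - z *s v" for v
    proof -
      have "mat z *v v = z *s v"
        by (simp add: vec_eq_iff matrix_vector_mult_def mat_def mult_delta_left)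
      then show ?thesis
        by (simp add: matrix_vector_mult_diff_rdistrib)
    qed
    then show ?thesis
      unfolding invertible_left_inverse matrix_left_invertible_ker
      by (auto simp: mat_eigenvalues_def)
  qed
  moreover have "transpose (M - mat z) = transpose M - mat z" for z
    by (simp add: vec_eq_iff transpose_def mat_def)
  moreover have "invertible (transpose N) \<longleftrightarrow> invertible N" for N :: "complex ^ 'n ^ 'n"
    by (simp add: invertible_det_nz)
  ultimately show ?thesis
    by (metis subsetI subset_antisym)
qed

lemma spectral_radius_transpose: "spectral_radius (transpose M) = spectral_radius M"
proof -
  have "(\<chi> i j. complex_of_real (transpose M $ i $ j)) =
      transpose (\<chi> i j. complex_of_real (M $ i $ j))"
    by (simp add: vec_eq_iff transpose_def)
  then show ?thesis
    by (simp add: spectral_radius_def complex_eigenvalues_alt mat_eigenvalues_transpose)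
qed

lemma matrix_power_Suc: "matrix_power M (Suc k) = M ** matrix_power M k"
  by (simp add: matrix_power_def)

lemma matrix_power_0 [simp]: "matrix_power M 0 = mat 1"
  by (simp add: matrix_power_def)

lemma matrix_power_vector: "matrix_power M k *v x = (((*v) M) ^^ k) x"
  by (induction k) (simp_all add: matrix_power_Suc flip: matrix_vector_mul_assoc)

lemma matrix_power_bound:
  fixes M :: "real ^ 'n ^ 'n"
  assumes "spectral_radius M < r"
  obtains C where "C > 0" "\<And>k x. norm (matrix_power M k *v x) \<le> C * r ^ k * norm x"
proof -
  define cx :: "real ^ 'n \<Rightarrow> complex ^ 'n" where "cx x = (\<chi> i. complex_of_real (x $ i))" for x
  define M' where "M' = (\<chi> i j. complex_of_real (M $ i $ j))"
  have norm_cx: "norm (cx x) = norm x" for x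
    by (simp add: cx_def norm_vec_def L2_set_def)
  have pow: "(((*v) M') ^^ k) (cx x) = cx (matrix_power M k *v x)" for k x
    by (induction k)
       (simp_all add: matrix_power_vector cx_def M'_def complexify_mult)
  have r: "r > 0"
    using spectral_radius_nonneg[of M] assms by linarith
  have "cmod z < r" if "z \<in> mat_eigenvalues M'" for z
    using assms that by (simp add: spectral_radius_less_iff complex_eigenvalues_alt M'_def)
  then have "\<exists>C. \<forall>k. norm ((((*v) M') ^^ k) (cx x)) \<le> C * r ^ k" for x
    by (rule matrix_powers_bound_vector)
  then have "\<exists>C. \<forall>k. norm (matrix_power M k *v x) \<le> C * r ^ k" for x
    by (simp add: pow norm_cx)
  then obtain c where c: "\<And>x k. norm (matrix_power M k *v x) \<le> c x * r ^ k"
    by metis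
  \<comment> \<open>The constants obtained so far depend on the vector; those of the basis vectors
    suffice by linearity. Adding 1 makes \<open>C\<close> positive.\<close>
  define C where "C = (\<Sum>i\<in>UNIV. \<bar>c (axis i 1)\<bar>) + 1"
  have "norm (matrix_power M k *v x) \<le> C * r ^ k * norm x" for k x
  proof -
    have "matrix_power M k *v (\<Sum>i\<in>UNIV. x $ i *s axis i 1) =
        (\<Sum>i\<in>UNIV. x $ i *\<^sub>R (matrix_power M k *v axis i 1))"
      by (simp add: vec.sum scalar_mult_eq_scaleR matrix_vector_mult_scaleR)
    then have "matrix_power M k *v x = (\<Sum>i\<in>UNIV. x $ i *\<^sub>R (matrix_power M k *v axis i 1))"
      by (simp add: basis_expansion)
    also have "norm \<dots> \<le> (\<Sum>i\<in>UNIV. norm x * (\<bar>c (axis i 1)\<bar> * r ^ k))"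
    proof (rule sum_norm_le)
      fix i
      have "norm (matrix_power M k *v axis i 1) \<le> \<bar>c (axis i 1)\<bar> * r ^ k"
        using c[of k "axis i 1"] r by (smt (verit) mult_right_mono zero_le_power)
      then show "norm (x $ i *\<^sub>R (matrix_power M k *v axis i 1)) \<le> norm x * (\<bar>c (axis i 1)\<bar> * r ^ k)"
        by (auto intro!: mult_mono component_le_norm_cart)
    qed
    also have "\<dots> = (C - 1) * r ^ k * norm x"
      by (simp add: C_def sum_distrib_left sum_distrib_right mult_ac)
    also have "\<dots> \<le> C * r ^ k * norm x"
      using r by (intro mult_right_mono) auto
    finally show ?thesis .
  qed
  moreover have "C > 0"
    by (simp add: C_def sum_nonneg add_nonneg_pos)
  ultimately show ?thesis
    using that by blast
qed

section \<open>Stable linear recursions\<close>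

lemma matrix_power_add: "matrix_power M (j + k) *v x = matrix_power M j *v (matrix_power M k *v x)"
  by (simp add: matrix_power_vector funpow_add)

lemma matrix_power_commute: "matrix_power M k *v (M *v x) = M *v (matrix_power M k *v x)"
  by (simp add: matrix_power_vector funpow_swap1)

lemma spectral_norm_bound: "norm (M *v x) \<le> spectral_norm M * norm x"
  unfolding spectral_norm_def by (rule onorm) (rule matrix_vector_mul_bounded_linear)

lemma spectral_norm_nonneg: "0 \<le> spectral_norm M"
  unfolding spectral_norm_def by (rule onorm_pos_le) (rule matrix_vector_mul_bounded_linear)

lemma spectral_norm_bound': "norm x \<le> X \<Longrightarrow> norm (M *v x) \<le> spectral_norm M * X"
  by (rule order_trans[OF spectral_norm_bound]) (intro mult_left_mono spectral_norm_nonneg)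

text \<open>The truncation error involves powers of \<open>transpose F\<close>, whereas the final
  bound is in terms of powers of \<open>F\<close>.\<close>

lemma norm_transpose_mult_le: "norm (transpose M *v x) \<le> spectral_norm M * norm x"
proof (cases "transpose M *v x = 0")
  case False
  define y where "y = transpose M *v x"
  have "norm y * norm y = x \<bullet> (M *v y)"
    unfolding y_def by (simp add: dot_lmul_matrix flip: power2_eq_square power2_norm_eq_inner)
       (metis dot_lmul_matrix power2_norm_eq_inner)
  also have "\<dots> \<le> norm x * norm (M *v y)"
    by (rule norm_cauchy_schwarz)
  also have "\<dots> \<le> norm x * (spectral_norm M * norm y)"
    by (intro mult_left_mono spectral_norm_bound) simp
  finally have "norm y * norm y \<le> (spectral_norm M * norm x) * norm y"
    by (simp add: mult_ac)
  then show ?thesis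
    using False by (simp add: y_def del: transpose_matrix_vector)
qed (simp add: spectral_norm_nonneg)

lemma transpose_matrix_power_commute:
  "transpose (matrix_power M k) *v x = matrix_power (transpose M) k *v x"
proof (induction k arbitrary: x)
  case (Suc k)
  have "transpose (matrix_power M (Suc k)) *v x = transpose (matrix_power M k) *v (transpose M *v x)"
    by (simp only: matrix_power_Suc matrix_transpose_mul matrix_vector_mul_assoc)
  also have "\<dots> = matrix_power (transpose M) (Suc k) *v x"
    by (simp only: Suc matrix_power_Suc flip: matrix_vector_mul_assoc) (simp only: matrix_power_commute)
  finally show ?case .
qed (simp only: matrix_power_0 transpose_mat)

locale stable_matrix =
  fixes M :: "real ^ 'n ^ 'n"
  assumes stable: "spectral_radius M < 1"
begin

text \<open>\<open>N\<close> is the supremum of the orbit rescaled by \<open>r ^ k\<close>. Applying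
  \<open>M\<close> shifts the orbit by one index, which costs a factor \<open>r\<close>, so
  \<open>M\<close> becomes a strict contraction in a single step.\<close>

lemma exists_adapted_norm:
  "\<exists>N r c. 0 < r \<and> r < 1 \<and> 0 < c \<and>
     (\<forall>x. norm x \<le> N x \<and> N x \<le> c * norm x) \<and> (\<forall>x y. N (x + y) \<le> N x + N y) \<and>
     (\<forall>x. N (M *v x) \<le> r * N x)"
proof -
  define r where "r = (1 + spectral_radius M) / 2"
  have r: "spectral_radius M < r" "0 < r" "r < 1"
    using stable spectral_radius_nonneg[of M] by (auto simp: r_def)
  obtain C where C: "C > 0" "\<And>k x. norm (matrix_power M k *v x) \<le> C * r ^ k * norm x"
    using matrix_power_bound[OF r(1)] by blast
  define g where "g x k = norm (matrix_power M k *v x) / r ^ k" for x k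
  define N where "N x = (SUP k. g x k)" for x
  have g: "g x k \<le> C * norm x" for x k
    using C(2)[of k x] r(2) by (simp add: g_def field_simps)
  have bdd: "bdd_above (range (g x))" for x
    using g by (intro bdd_aboveI[of _ "C * norm x"]) auto
  have gN: "g x k \<le> N x" for x k
    unfolding N_def by (intro cSUP_upper bdd) simp
  have "norm x \<le> N x" for x
    using gN[of x 0] by (simp add: g_def)
  moreover have "N x \<le> C * norm x" for x
    unfolding N_def by (intro cSUP_least g) simp
  moreover have "N (x + y) \<le> N x + N y" for x y
  proof -
    have "g (x + y) k \<le> g x k + g y k" for k
      using r by (simp add: g_def matrix_vector_right_distrib divide_right_mono norm_triangle_ineq
          flip: add_divide_distrib)
    then show ?thesis
      unfolding N_def[of "x + y"]
      using gN by (intro cSUP_least) (simp, meson order_trans add_mono)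
  qed
  moreover have "N (M *v x) \<le> r * N x" for x
  proof -
    have "g (M *v x) k = r * g x (Suc k)" for k
      using r by (simp add: g_def matrix_power_commute matrix_power_Suc flip: matrix_vector_mul_assoc)
    then have "g (M *v x) k \<le> r * N x" for k
      using gN r by simp
    then show ?thesis
      unfolding N_def[of "M *v x"] by (intro cSUP_least) auto
  qed
  ultimately show ?thesis
    using r C(1) by blast
qed

lemma bounded_recursion:
  obtains c where "c > 0"
    "\<And>x v V T t. \<forall>t<T. x (Suc t) = M *v x t + v t \<Longrightarrow> \<forall>t<T. norm (v t) \<le> V \<Longrightarrow> 0 \<le> V \<Longrightarrow> t \<le> T \<Longrightarrow>
      norm (x t) \<le> c * (norm (x 0) + V)"
proof -
  obtain N r c where N: "0 < r" "r < 1" "0 < c" "\<And>x. norm x \<le> N x" "\<And>x. N x \<le> c * norm x"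
    "\<And>x y. N (x + y) \<le> N x + N y" "\<And>x. N (M *v x) \<le> r * N x"
    using exists_adapted_norm by blast
  have *: "norm (x t) \<le> c / (1 - r) * (norm (x 0) + V)"
    if x: "\<forall>t<T. x (Suc t) = M *v x t + v t" and v: "\<forall>t<T. norm (v t) \<le> V" and V: "0 \<le> V"
      and t: "t \<le> T"
    for x :: "nat \<Rightarrow> real ^ 'n" and v V T t
  proof -
    \<comment> \<open>\<open>b\<close> solves \<open>b = r * b + c * (norm (x 0) + V)\<close>, so
      the region \<open>N x \<le> b\<close> contains the start and is invariant.\<close>
    define b where "b = c / (1 - r) * (norm (x 0) + V)"
    have b: "c * norm (x 0) \<le> b" "r * b + c * V \<le> b"
    proof -
      have "b = r * b + c * (norm (x 0) + V)"
        using N by (simp add: b_def field_simps)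
      moreover have "r * b \<ge> 0" "c * V \<ge> 0" "c * norm (x 0) \<ge> 0"
        using N V by (simp_all add: b_def)
      ultimately show "c * norm (x 0) \<le> b" "r * b + c * V \<le> b"
        by (simp_all add: distrib_left)
    qed
    have "N (x t) \<le> b"
      using t
    proof (induction t)
      case 0
      then show ?case
        using N(5)[of "x 0"] b by linarith
    next
      case (Suc t)
      have "N (x (Suc t)) \<le> N (M *v x t) + N (v t)"
        using x Suc.prems N(6) by simp
      also have "\<dots> \<le> r * N (x t) + c * norm (v t)"
        by (intro add_mono N)
      also have "\<dots> \<le> r * b + c * V"
        using Suc v N by (intro add_mono mult_left_mono) auto
      finally show ?case
        using b by linarith
    qed
    then show ?thesis
      using N(4)[of "x t"] by (simp add: b_def)
  qed
  show ?thesis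
  proof (rule that)
    show "c / (1 - r) > 0"
      using N by simp
  qed (rule *)
qed

lemma summable_recursion:
  obtains c where "c > 0"
    "\<And>x v T. \<forall>t<T. x (Suc t) = M *v x t + v t \<Longrightarrow>
      (\<Sum>t<T. norm (x t)) \<le> c * (norm (x 0) + (\<Sum>t<T. norm (v t)))"
proof -
  obtain N r c where N: "0 < r" "r < 1" "0 < c" "\<And>x. norm x \<le> N x" "\<And>x. N x \<le> c * norm x"
    "\<And>x y. N (x + y) \<le> N x + N y" "\<And>x. N (M *v x) \<le> r * N x"
    using exists_adapted_norm by blast
  have *: "(\<Sum>t<T. norm (x t)) \<le> c / (1 - r) * (norm (x 0) + (\<Sum>t<T. norm (v t)))"
    if x: "\<forall>t<T. x (Suc t) = M *v x t + v t" for x :: "nat \<Rightarrow> real ^ 'n" and v T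
  proof -
    \<comment> \<open>Keeping \<open>N (x T)\<close> on the left makes the induction close: the next
      step trades it for \<open>r * N (x T)\<close> and leaves \<open>(1 - r) * N (x T)\<close> to
      the sum.\<close>
    have "N (x T) + (1 - r) * (\<Sum>t<T. N (x t)) \<le> c * (norm (x 0) + (\<Sum>t<T. norm (v t)))"
      using x
    proof (induction T)
      case (Suc T)
      have "N (x (Suc T)) \<le> N (M *v x T) + N (v T)"
        using Suc.prems N(6) by simp
      also have "\<dots> \<le> r * N (x T) + c * norm (v T)"
        by (intro add_mono N)
      finally show ?case
        using Suc by (simp add: algebra_simps)
    qed (simp add: N)
    moreover have "N (x T) \<ge> 0"
      using N(4)[of "x T"] norm_ge_zero[of "x T"] by linarith
    moreover have "(1 - r) * (\<Sum>t<T. norm (x t)) \<le> (1 - r) * (\<Sum>t<T. N (x t))"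
      using N by (intro mult_left_mono sum_mono) auto
    ultimately have "(1 - r) * (\<Sum>t<T. norm (x t)) \<le> c * (norm (x 0) + (\<Sum>t<T. norm (v t)))"
      by linarith
    then show ?thesis
      using N by (simp add: field_simps)
  qed
  show ?thesis
  proof (rule that)
    show "c / (1 - r) > 0"
      using N by simp
  qed (rule *)
qed

end

lemma geometric_sum_bound:
  assumes "0 \<le> (r :: real)" "r < 1"
  shows "(\<Sum>i<k. r ^ i) \<le> 1 / (1 - r)"
proof -
  have "(1 - r) * (\<Sum>i<k. r ^ i) = 1 - r ^ k"
    by (rule one_diff_power_eq[symmetric])
  also have "\<dots> \<le> 1"
    using assms by simp
  finally show ?thesis
    using assms by (simp add: field_simps)
qed

section \<open>Semidefinite matrices\<close>

lemma transpose_add: "transpose (M + N) = transpose M + transpose N"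
  and transpose_diff: "transpose (M - N') = transpose M - transpose N'"
  by (simp_all add: vec_eq_iff transpose_def)

lemma inner_transpose:
  fixes M :: "real ^ 'n ^ 'm"
  shows "x \<bullet> (transpose M *v y) = (M *v x) \<bullet> y"
  by (metis dot_lmul_matrix inner_commute transpose_matrix_vector)

lemma inner_symmetric:
  fixes S :: "real ^ 'n ^ 'n"
  assumes "transpose S = S"
  shows "x \<bullet> (S *v y) = y \<bullet> (S *v x)"
  using inner_transpose[of x S y] assms by (simp add: inner_commute)

lemma quadratic_form_le: "x \<bullet> (S *v x) \<le> spectral_norm S * (norm x)\<^sup>2"
proof -
  have "x \<bullet> (S *v x) \<le> norm x * norm (S *v x)"
    by (rule norm_cauchy_schwarz)
  also have "\<dots> \<le> norm x * (spectral_norm S * norm x)"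
    by (intro mult_left_mono spectral_norm_bound) simp
  finally show ?thesis
    by (simp add: power2_eq_square mult_ac)
qed

lemma quadratic_form_le':
  assumes "norm x \<le> X"
  shows "x \<bullet> (S *v x) \<le> spectral_norm S * X\<^sup>2"
  by (rule order_trans[OF quadratic_form_le])
     (intro mult_left_mono power_mono assms spectral_norm_nonneg norm_ge_zero)

lemma pos_semidef_norm_mult:
  assumes "pos_semidef S"
  shows "(norm (S *v x))\<^sup>2 \<le> spectral_norm S * (x \<bullet> (S *v x))"
proof (cases "spectral_norm S = 0")
  case True
  then show ?thesis
    using spectral_norm_bound[of S x] by simp
next
  case False
  define s where "s = spectral_norm S"
  have s: "s > 0"
    using False spectral_norm_nonneg[of S] by (simp add: s_def)
  define y where "y = S *v x"
  \<comment> \<open>This is the form after a gradient step of length \<open>1 / s\<close>; its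
    nonnegativity is the claimed inequality once
    \<open>y \<bullet> (S *v y) \<le> s * (y \<bullet> y)\<close> is inserted.\<close>
  have "0 \<le> (x - (1 / s) *\<^sub>R y) \<bullet> (S *v (x - (1 / s) *\<^sub>R y))"
    using assms by (simp add: pos_semidef_def)
  also have "\<dots> = x \<bullet> y - 2 / s * (y \<bullet> y) + (1 / s)\<^sup>2 * (y \<bullet> (S *v y))"
    using inner_symmetric[of S x y] assms
    by (simp add: pos_semidef_def y_def matrix_vector_mult_diff_distrib matrix_vector_mult_scaleR
        inner_diff_left inner_diff_right power2_eq_square inner_commute algebra_simps)
  also have "\<dots> \<le> x \<bullet> y - 2 / s * (y \<bullet> y) + (1 / s)\<^sup>2 * (s * (y \<bullet> y))"
    using quadratic_form_le[of y S]
    by (intro add_left_mono mult_left_mono) (simp_all add: s_def power2_norm_eq_inner)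
  also have "\<dots> = x \<bullet> y - (y \<bullet> y) / s"
    using s by (simp add: power2_eq_square field_simps)
  finally have "y \<bullet> y \<le> s * (x \<bullet> y)"
    using s by (simp add: field_simps)
  then show ?thesis
    by (simp add: s_def y_def power2_norm_eq_inner)
qed

lemma pos_def_imp_pos_semidef: "pos_def S \<Longrightarrow> pos_semidef S"
  by (auto simp: pos_def_def pos_semidef_def) (metis inner_zero_left less_imp_le order_refl)

lemma pos_def_inverse:
  assumes "pos_def S"
  shows "S *v (matrix_inv S *v x) = x" "matrix_inv S *v (S *v x) = x"
proof -
  have "\<forall>x. S *v x = 0 \<longrightarrow> x = 0"
    using assms by (metis inner_zero_right less_irrefl pos_def_def)
  then have "invertible S"
    unfolding invertible_left_inverse matrix_left_invertible_ker .
  then have "S ** matrix_inv S = mat 1 \<and> matrix_inv S ** S = mat 1"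
    unfolding invertible_def matrix_inv_def by (rule someI_ex)
  then show "S *v (matrix_inv S *v x) = x" "matrix_inv S *v (S *v x) = x"
    by (simp_all add: matrix_vector_mul_assoc)
qed

lemma pos_def_norm_bound:
  fixes S :: "real ^ 'n ^ 'n"
  assumes "pos_def S"
  shows "\<exists>c\<ge>0. \<forall>x. (norm x)\<^sup>2 \<le> c * (x \<bullet> (S *v x))"
proof (intro exI conjI allI)
  let ?c = "(spectral_norm (matrix_inv S))\<^sup>2 * spectral_norm S"
  show "?c \<ge> 0"
    by (simp add: spectral_norm_nonneg)
  fix x
  have "norm x \<le> spectral_norm (matrix_inv S) * norm (S *v x)"
    using spectral_norm_bound[of "matrix_inv S" "S *v x"] pos_def_inverse[OF assms] by simp
  then have "(norm x)\<^sup>2 \<le> (spectral_norm (matrix_inv S))\<^sup>2 * (norm (S *v x))\<^sup>2"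
    by (metis power_mono norm_ge_zero power_mult_distrib)
  also have "\<dots> \<le> (spectral_norm (matrix_inv S))\<^sup>2 * (spectral_norm S * (x \<bullet> (S *v x)))"
    by (intro mult_left_mono pos_semidef_norm_mult pos_def_imp_pos_semidef assms) simp
  finally show "(norm x)\<^sup>2 \<le> ?c * (x \<bullet> (S *v x))"
    by (simp add: mult_ac)
qed

text \<open>Real and imaginary parts of an eigenvector, so that real quadratic forms can be
  evaluated on it.\<close>

lemma complex_eigenvalues_real:
  "z \<in> complex_eigenvalues M \<longleftrightarrow>
     (\<exists>a b. (a \<noteq> 0 \<or> b \<noteq> 0) \<and> M *v a = Re z *\<^sub>R a - Im z *\<^sub>R b \<and> M *v b = Im z *\<^sub>R a + Re z *\<^sub>R b)"
proof
  assume "z \<in> complex_eigenvalues M"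
  then obtain v where v: "v \<noteq> 0" "(\<chi> i j. complex_of_real (M $ i $ j)) *v v = z *s v"
    by (auto simp: complex_eigenvalues_def)
  have "(\<Sum>j\<in>UNIV. complex_of_real (M $ i $ j) * v $ j) = z * v $ i" for i
    using v(2) by (simp add: vec_eq_iff matrix_vector_mult_def)
  from arg_cong[OF this, of Re] arg_cong[OF this, of Im]
  have "(\<Sum>j\<in>UNIV. M $ i $ j * Re (v $ j)) = Re (z * v $ i)"
    and "(\<Sum>j\<in>UNIV. M $ i $ j * Im (v $ j)) = Im (z * v $ i)" for i
    by (simp_all add: Re_sum Im_sum)
  then show "\<exists>a b. (a \<noteq> 0 \<or> b \<noteq> 0) \<and> M *v a = Re z *\<^sub>R a - Im z *\<^sub>R b
      \<and> M *v b = Im z *\<^sub>R a + Re z *\<^sub>R b"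
    using v(1)
    by (intro exI[of _ "\<chi> i. Re (v $ i)"] exI[of _ "\<chi> i. Im (v $ i)"])
       (auto simp: vec_eq_iff matrix_vector_mult_def complex_eq_iff)
next
  assume "\<exists>a b. (a \<noteq> 0 \<or> b \<noteq> 0) \<and> M *v a = Re z *\<^sub>R a - Im z *\<^sub>R b
      \<and> M *v b = Im z *\<^sub>R a + Re z *\<^sub>R b"
  then obtain a b where ab: "a \<noteq> 0 \<or> b \<noteq> 0" "M *v a = Re z *\<^sub>R a - Im z *\<^sub>R b"
      "M *v b = Im z *\<^sub>R a + Re z *\<^sub>R b"
    by blast
  define v where "v = (\<chi> i. Complex (a $ i) (b $ i))"
  have "v \<noteq> 0"
    using ab(1) by (auto simp: v_def vec_eq_iff complex_eq_iff)
  moreover have "(\<chi> i j. complex_of_real (M $ i $ j)) *v v = z *s v"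
    using ab(2,3) by (simp add: v_def vec_eq_iff matrix_vector_mult_def complex_eq_iff)
  ultimately show "z \<in> complex_eigenvalues M"
    by (auto simp: complex_eigenvalues_def)
qed

section \<open>Completing the square in the Riccati equation\<close>

locale riccati =
  fixes A :: "real ^ 'n ^ 'n" and B :: "real ^ 'd ^ 'n"
    and Q P F :: "real ^ 'n ^ 'n" and R :: "real ^ 'd ^ 'd"
  assumes Q: "pos_semidef Q" and R: "pos_def R" and P: "pos_semidef P"
    and detect: "detectable A Q"
    and P_eq: "P = Q + transpose A ** P ** A
              - transpose A ** P ** B ** matrix_inv (R + transpose B ** P ** B)
                  ** transpose B ** P ** A"
    and F_eq: "F = A - B ** matrix_inv (R + transpose B ** P ** B) ** transpose B ** P ** A"
begin

definition "G = R + transpose B ** P ** B"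
definition "H = matrix_inv G ** transpose B"

lemma P_sym: "transpose P = P"
  using P by (simp add: pos_semidef_def)

lemma form_nonneg: "0 \<le> x \<bullet> (P *v x)" "0 \<le> x \<bullet> (Q *v x)" "0 \<le> u \<bullet> (R *v u)"
  using P Q pos_def_imp_pos_semidef[OF R] by (simp_all add: pos_semidef_def)

lemma G_apply: "G *v u = R *v u + transpose B *v (P *v (B *v u))"
  by (simp add: G_def matrix_vector_mult_add_rdistrib del: transpose_matrix_vector
      flip: matrix_vector_mul_assoc)

lemma G_form: "u \<bullet> (G *v v) = u \<bullet> (R *v v) + (B *v u) \<bullet> (P *v (B *v v))"
  by (simp add: G_apply inner_add_right inner_transpose del: transpose_matrix_vector)

lemma G_pos_def: "pos_def G"
proof -
  have "transpose G = G"
    using R by (simp add: G_def pos_def_def transpose_add matrix_transpose_mul matrix_mul_assoc P_sym)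
  moreover have "u \<bullet> (G *v u) > 0" if "u \<noteq> 0" for u
    using R that form_nonneg(1)[of "B *v u"] by (simp add: G_form pos_def_def add_pos_nonneg)
  ultimately show ?thesis
    by (simp add: pos_def_def)
qed

lemma G_H: "G *v (H *v y) = transpose B *v y"
  unfolding H_def matrix_vector_mul_assoc[symmetric] by (rule pos_def_inverse[OF G_pos_def])

lemma G_sym: "u \<bullet> (G *v v) = v \<bullet> (G *v u)"
  using G_pos_def by (intro inner_symmetric) (simp add: pos_def_def)

lemma P_apply: "P *v x = Q *v x + transpose A *v (P *v (A *v x))
    - transpose A *v (P *v (B *v (H *v (P *v (A *v x)))))"
  by (subst P_eq) (simp add: H_def G_def matrix_vector_mult_add_rdistrib
      matrix_vector_mult_diff_rdistrib del: transpose_matrix_vector flip: matrix_vector_mul_assoc)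

lemma F_apply: "F *v x = A *v x - B *v (H *v (P *v (A *v x)))"
  by (subst F_eq) (simp add: H_def G_def matrix_vector_mult_diff_rdistrib del: transpose_matrix_vector
      flip: matrix_vector_mul_assoc)

text \<open>One step of dynamic programming with a known disturbance.
  \<open>2 * (z \<bullet> p)\<close> is the linear part of the value at the next state,
  \<open>d\<close> the deviation from the minimizing control, and the last bracket is free of state
  and control.\<close>

lemma complete_square:
  fixes x w p :: "real ^ 'n" and u :: "real ^ 'd"
  defines "q \<equiv> P *v w + p"
  defines "z \<equiv> A *v x + B *v u + w"
  defines "d \<equiv> u + H *v (P *v (A *v x) + q)"
  shows "x \<bullet> (Q *v x) + u \<bullet> (R *v u) + (z \<bullet> (P *v z) + 2 * (z \<bullet> p)) =
    (x \<bullet> (P *v x) + 2 * (x \<bullet> (transpose F *v q))) + d \<bullet> (G *v d)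
      + (w \<bullet> (P *v w) + 2 * (w \<bullet> p) - q \<bullet> (B *v (H *v q)))"
proof -
  define a where "a = A *v x"
  define b where "b = B *v u"
  define h where "h = H *v (P *v a)"
  define g where "g = H *v q"
  have Pc: "y \<bullet> (P *v y') = y' \<bullet> (P *v y)" for y y'
    using P_sym by (rule inner_symmetric)
  have d: "d = u + h + g"
    by (simp add: d_def a_def h_def g_def matrix_vector_right_distrib)
  have Gh: "v \<bullet> (G *v h) = (B *v v) \<bullet> (P *v a)" and Gg: "v \<bullet> (G *v g) = (B *v v) \<bullet> q" for v
    by (simp_all add: h_def g_def G_H inner_transpose del: transpose_matrix_vector)
  have "d \<bullet> (G *v d) = u \<bullet> (G *v u) + 2 * (u \<bullet> (G *v h)) + 2 * (u \<bullet> (G *v g))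
      + h \<bullet> (G *v h) + 2 * (h \<bullet> (G *v g)) + g \<bullet> (G *v g)"
    using G_sym[of h u] G_sym[of g u] G_sym[of g h]
    by (simp add: d matrix_vector_right_distrib inner_add_left inner_add_right)
  then have dGd: "d \<bullet> (G *v d) = u \<bullet> (R *v u) + b \<bullet> (P *v b) + 2 * (b \<bullet> (P *v a)) + 2 * (b \<bullet> q)
      + (B *v h) \<bullet> (P *v a) + 2 * ((B *v h) \<bullet> q) + (B *v g) \<bullet> q"
    by (simp add: Gh Gg G_form[of u u] b_def)
  have xPx: "x \<bullet> (P *v x) = x \<bullet> (Q *v x) + a \<bullet> (P *v a) - (B *v h) \<bullet> (P *v a)"
    using Pc[of a "B *v h"]
    by (subst P_apply) (simp add: inner_add_right inner_diff_right inner_transpose a_def h_def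
        del: transpose_matrix_vector)
  have xFq: "x \<bullet> (transpose F *v q) = a \<bullet> q - (B *v h) \<bullet> q"
    by (simp add: inner_transpose F_apply a_def h_def inner_diff_left del: transpose_matrix_vector)
  have zPz: "z \<bullet> (P *v z) = a \<bullet> (P *v a) + b \<bullet> (P *v b) + w \<bullet> (P *v w) + 2 * (b \<bullet> (P *v a))
      + 2 * (a \<bullet> (P *v w)) + 2 * (b \<bullet> (P *v w))"
    using Pc[of a b] Pc[of w a] Pc[of w b]
    by (simp add: z_def a_def b_def matrix_vector_right_distrib inner_add_left inner_add_right)
  have zp: "z \<bullet> p = a \<bullet> p + b \<bullet> p + w \<bullet> p"
    by (simp add: z_def a_def b_def inner_add_left)
  have q: "y \<bullet> q = y \<bullet> (P *v w) + y \<bullet> p" for y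
    by (simp add: q_def inner_add_right)
  show ?thesis
    unfolding dGd xPx xFq zPz zp g_def[symmetric] inner_commute[of q] by (simp add: q[of a] q[of b])
qed

text \<open>The deviation vanishes for the linear feedback without disturbance, which leaves the
  Lyapunov identity of \<open>F\<close>.\<close>

lemma closed_loop_form:
  "x \<bullet> (Q *v x) + (H *v (P *v (A *v x))) \<bullet> (R *v (H *v (P *v (A *v x))))
     + (F *v x) \<bullet> (P *v (F *v x)) = x \<bullet> (P *v x)"
proof -
  have "A *v x + B *v (- (H *v (P *v (A *v x)))) = F *v x"
    by (simp add: F_apply vec.neg)
  then show ?thesis
    using complete_square[of x "- (H *v (P *v (A *v x)))" 0 0] by (simp add: vec.neg)
qed

lemma detector:
  obtains L where "spectral_radius (A - L ** Q) < 1"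
proof -
  obtain K where "spectral_radius (transpose A - Q ** K) < 1"
    using detect by (auto simp: detectable_def stabilizable_def)
  then have "spectral_radius (transpose (transpose A - Q ** K)) < 1"
    by (simp add: spectral_radius_transpose)
  then have "spectral_radius (A - transpose K ** Q) < 1"
    using Q by (simp add: transpose_diff matrix_transpose_mul pos_semidef_def)
  then show ?thesis
    by (rule that)
qed

text \<open>If \<open>cmod z \<ge> 1\<close>, summing the Lyapunov identity over the real and
  imaginary parts of an eigenvector forces \<open>Q\<close> and the feedback to vanish on both.
  There \<open>F\<close> agrees with \<open>A - L ** Q\<close> for every \<open>L\<close>, so
  \<open>z\<close> is an eigenvalue of every such matrix, against detectability.\<close>

lemma F_stable: "spectral_radius F < 1"
  unfolding spectral_radius_less_iff
proof (intro ballI, rule ccontr)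
  fix z
  assume "z \<in> complex_eigenvalues F" and z: "\<not> cmod z < 1"
  then obtain a b where ab: "a \<noteq> 0 \<or> b \<noteq> 0" and Fa: "F *v a = Re z *\<^sub>R a - Im z *\<^sub>R b"
      and Fb: "F *v b = Im z *\<^sub>R a + Re z *\<^sub>R b"
    unfolding complex_eigenvalues_real by blast
  define k where "k x = H *v (P *v (A *v x))" for x
  have "(F *v a) \<bullet> (P *v (F *v a)) + (F *v b) \<bullet> (P *v (F *v b)) =
      (cmod z)\<^sup>2 * (a \<bullet> (P *v a) + b \<bullet> (P *v b))"
    unfolding Fa Fb cmod_power2 using inner_symmetric[OF P_sym, of b a]
    by (simp add: matrix_vector_right_distrib matrix_vector_mult_diff_distrib
        matrix_vector_mult_scaleR inner_add_left inner_add_right inner_diff_left inner_diff_right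
        algebra_simps power2_eq_square)
  also have "\<dots> \<ge> 1 * (a \<bullet> (P *v a) + b \<bullet> (P *v b))"
    using z form_nonneg by (intro mult_right_mono) (auto simp: one_le_power)
  finally have "a \<bullet> (Q *v a) + b \<bullet> (Q *v b) + k a \<bullet> (R *v k a) + k b \<bullet> (R *v k b) \<le> 0"
    using closed_loop_form[of a] closed_loop_form[of b] by (simp add: k_def)
  then have zero: "a \<bullet> (Q *v a) = 0" "b \<bullet> (Q *v b) = 0" "k a \<bullet> (R *v k a) = 0" "k b \<bullet> (R *v k b) = 0"
    using form_nonneg(2)[of a] form_nonneg(2)[of b] form_nonneg(3)[of "k a"] form_nonneg(3)[of "k b"]
    by linarith+
  have "Q *v a = 0" "Q *v b = 0"
    using pos_semidef_norm_mult[OF Q, of a] pos_semidef_norm_mult[OF Q, of b] zero by simp_all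
  moreover have "k a = 0" "k b = 0"
    using R zero(3,4) by (metis less_irrefl pos_def_def)+
  ultimately have "(A - L ** Q) *v a = F *v a" "(A - L ** Q) *v b = F *v b" for L
    by (simp_all add: F_apply k_def matrix_vector_mult_diff_rdistrib flip: matrix_vector_mul_assoc)
  then have "z \<in> complex_eigenvalues (A - L ** Q)" for L
    unfolding complex_eigenvalues_real using ab Fa Fb by (intro exI[of _ a] exI[of _ b]) simp
  moreover obtain L where "spectral_radius (A - L ** Q) < 1"
    by (rule detector)
  ultimately show False
    using z by (auto simp: spectral_radius_less_iff)
qed

end

section \<open>Optimal and truncated lookahead policies\<close>

lemma lin_state_shift:
  "lin_state A B x u w (Suc t) =
     lin_state A B (A *v x + B *v u 0 + w 0) (\<lambda>t. u (Suc t)) (\<lambda>t. w (Suc t)) t"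
  by (induction t) simp_all

lemma lq_cost_shift:
  "lq_cost A B Q R S x (Suc T) u w = x \<bullet> (Q *v x) + u 0 \<bullet> (R *v u 0) +
     lq_cost A B Q R S (A *v x + B *v u 0 + w 0) T (\<lambda>t. u (Suc t)) (\<lambda>t. w (Suc t))"
  unfolding lq_cost_def sum.lessThan_Suc_shift lin_state_shift by simp

lemma lin_state_cong:
  "(\<And>i. i < t \<Longrightarrow> u i = u' i) \<Longrightarrow> (\<And>i. i < t \<Longrightarrow> w i = w' i) \<Longrightarrow>
     lin_state A B x u w t = lin_state A B x u' w' t"
  by (induction t) simp_all

lemma lq_cost_cong:
  assumes "\<And>i. i < T \<Longrightarrow> u i = u' i" "\<And>i. i < T \<Longrightarrow> w i = w' i"
  shows "lq_cost A B Q R S x T u w = lq_cost A B Q R S x T u' w'"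
proof -
  have "lin_state A B x u w t = lin_state A B x u' w' t" if "t \<le> T" for t
    using that assms by (intro lin_state_cong) auto
  then show ?thesis
    using assms by (simp add: lq_cost_def)
qed

lemma lq_cost_terminal:
  "lq_cost A B Q R S x T u w =
     lq_cost A B Q R 0 x T u w + lin_state A B x u w T \<bullet> (S *v lin_state A B x u w T)"
  by (simp add: lq_cost_def)

text \<open>Controls and states define each other; running the recursion on the state alone breaks
  the circle.\<close>

lemma feedback_realization:
  "\<exists>u. \<forall>t. u t = \<phi> t (lin_state A B x u w t)"
proof -
  define s where "s = rec_nat x (\<lambda>t y. A *v y + B *v \<phi> t y + w t)"
  define u where "u t = \<phi> t (s t)" for t
  have "lin_state A B x u w t = s t" for t
    by (induction t) (simp_all add: s_def u_def)
  then show ?thesis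
    by (intro exI[of _ u]) (simp add: u_def)
qed

context riccati
begin

definition "costate w k = (\<Sum>i<k. matrix_power (transpose F) i *v (P *v w i))"

definition "opt_input x q = - (H *v (P *v (A *v x) + q))"

text \<open>Accumulates the last bracket of \<open>complete_square\<close>. It does not depend on
  the controls and is never estimated: it cancels when two control sequences are compared.\<close>

primrec value_offset :: "nat \<Rightarrow> (nat \<Rightarrow> real ^ 'n) \<Rightarrow> real" where
  "value_offset 0 w = 0"
| "value_offset (Suc T) w = value_offset T (\<lambda>t. w (Suc t)) + w 0 \<bullet> (P *v w 0)
     + 2 * (w 0 \<bullet> (transpose F *v costate (\<lambda>t. w (Suc t)) T))
     - costate w (Suc T) \<bullet> (B *v (H *v costate w (Suc T)))"

definition "opt_value T w x =
  x \<bullet> (P *v x) + 2 * (x \<bullet> (transpose F *v costate w T)) + value_offset T w"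

lemma costate_0 [simp]: "costate w 0 = 0"
  by (simp add: costate_def)

lemma costate_Suc: "costate w (Suc k) = P *v w 0 + transpose F *v costate (\<lambda>i. w (Suc i)) k"
  unfolding costate_def sum.lessThan_Suc_shift
  by (simp add: vec.sum matrix_power_Suc matrix_vector_mul_assoc matrix_mul_assoc
      del: transpose_matrix_vector)

lemma costate_add:
  "costate w (k + m) = costate w k + matrix_power (transpose F) k *v costate (\<lambda>i. w (k + i)) m"
  by (induction m)
     (simp_all add: costate_def matrix_vector_right_distrib matrix_power_add add.assoc)

lemma costate_zero_tail:
  assumes "\<And>i. i \<ge> k \<Longrightarrow> w i = 0"
  shows "costate w (k + m) = costate w k"
  using assms by (simp add: costate_add) (simp add: costate_def)

text \<open>Iterates \<open>complete_square\<close>, with \<open>p\<close> built from the costate of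
  the later disturbances. It is an identity for every control sequence, so the excess over the
  optimum can be read off from the deviations.\<close>

lemma lq_cost_decomposition:
  "lq_cost A B Q R P x T u w = opt_value T w x +
     (\<Sum>t<T. (u t - opt_input (lin_state A B x u w t) (costate (\<lambda>i. w (t + i)) (T - t))) \<bullet>
       (G *v (u t - opt_input (lin_state A B x u w t) (costate (\<lambda>i. w (t + i)) (T - t)))))"
proof (induction T arbitrary: x u w)
  case 0
  show ?case
    by (simp add: lq_cost_def opt_value_def)
next
  case (Suc T)
  have "lq_cost A B Q R P x (Suc T) u w = x \<bullet> (Q *v x) + u 0 \<bullet> (R *v u 0) +
      opt_value T (\<lambda>t. w (Suc t)) (A *v x + B *v u 0 + w 0) +
      (\<Sum>t<T. (u (Suc t) - opt_input (lin_state A B x u w (Suc t)) (costate (\<lambda>i. w (Suc t + i)) (T - t))) \<bullet>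
       (G *v (u (Suc t) - opt_input (lin_state A B x u w (Suc t)) (costate (\<lambda>i. w (Suc t + i)) (T - t)))))"
    unfolding lq_cost_shift Suc.IH lin_state_shift by simp
  moreover have "x \<bullet> (Q *v x) + u 0 \<bullet> (R *v u 0) +
      opt_value T (\<lambda>t. w (Suc t)) (A *v x + B *v u 0 + w 0) = opt_value (Suc T) w x +
      (u 0 - opt_input x (costate w (Suc T))) \<bullet> (G *v (u 0 - opt_input x (costate w (Suc T))))"
    using complete_square[where x = x and u = "u 0" and w = "w 0"
        and p = "transpose F *v costate (\<lambda>t. w (Suc t)) T"]
    by (simp add: opt_value_def opt_input_def flip: costate_Suc del: transpose_matrix_vector)
  ultimately show ?case
    unfolding sum.lessThan_Suc_shift by simp
qed

lemma G_nonneg: "0 \<le> u \<bullet> (G *v u)"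
  using pos_def_imp_pos_semidef[OF G_pos_def] by (simp add: pos_semidef_def)

lemma opt_value_le: "opt_value T w x \<le> lq_cost A B Q R P x T u w"
  unfolding lq_cost_decomposition by (simp add: sum_nonneg G_nonneg)

lemma lq_cost_optimal:
  assumes "\<And>t. t < T \<Longrightarrow> u t = opt_input (lin_state A B x u w t) (costate (\<lambda>i. w (t + i)) (T - t))"
  shows "lq_cost A B Q R P x T u w = opt_value T w x"
  using assms by (simp add: lq_cost_decomposition)

text \<open>\<open>arg_min\<close> is a choice operator, so existence comes first: the optimal
  feedback attains the lower bound. Any minimizer then has zero total deviation, which determines
  its first entry because \<open>G\<close> is positive definite.\<close>

lemma mpc_control_eq:
  assumes "k \<ge> 1"
  shows "mpc_control A B Q R P k x w = opt_input x (costate w k)"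
proof -
  obtain v where "\<forall>t. v t = opt_input (lin_state A B x v w t) (costate (\<lambda>i. w (t + i)) (k - t))"
    using feedback_realization[of "\<lambda>t y. opt_input y (costate (\<lambda>i. w (t + i)) (k - t))"] by blast
  then have v: "lq_cost A B Q R P x k v w = opt_value k w x"
    by (intro lq_cost_optimal) blast
  define u where "u = arg_min (\<lambda>u. lq_cost A B Q R P x k u w) (\<lambda>_. True)"
  have "is_arg_min (\<lambda>u. lq_cost A B Q R P x k u w) (\<lambda>_. True) v"
    using v opt_value_le by (simp add: is_arg_min_linorder)
  then have "is_arg_min (\<lambda>u. lq_cost A B Q R P x k u w) (\<lambda>_. True) u"
    unfolding u_def arg_min_def
    by (rule someI[where P = "is_arg_min (\<lambda>u. lq_cost A B Q R P x k u w) (\<lambda>_. True)"])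
  then have "lq_cost A B Q R P x k u w \<le> opt_value k w x"
    using v by (metis is_arg_min_linorder)
  moreover define g where "g t = (u t - opt_input (lin_state A B x u w t) (costate (\<lambda>i. w (t + i)) (k - t))) \<bullet>
       (G *v (u t - opt_input (lin_state A B x u w t) (costate (\<lambda>i. w (t + i)) (k - t))))" for t
  ultimately have "(\<Sum>t<k. g t) \<le> 0"
    by (simp add: lq_cost_decomposition)
  \<comment> \<open>Here \<open>k \<ge> 1\<close> matters: index 0 must occur in the sum.\<close>
  moreover have "g 0 \<le> (\<Sum>t<k. g t)"
    using assms by (intro member_le_sum) (auto simp: g_def G_nonneg)
  ultimately have "(u 0 - opt_input x (costate w k)) \<bullet> (G *v (u 0 - opt_input x (costate w k))) \<le> 0"
    by (simp add: g_def)
  then have "u 0 - opt_input x (costate w k) = 0"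
    using G_pos_def by (metis linorder_not_less pos_def_def)
  then show ?thesis
    by (simp add: mpc_control_def u_def)
qed

lemma mpc_state_eq:
  "lin_state A B x (mpc_input A B Q R P k x w) w t = mpc_state A B Q R P k x w t"
  by (induction t) (simp_all add: mpc_input_def)

lemma mpc_input_eq:
  assumes "k \<ge> 1"
  shows "mpc_input A B Q R P k x w t =
    opt_input (lin_state A B x (mpc_input A B Q R P k x w) w t) (costate (\<lambda>i. w (t + i)) k)"
  by (simp add: mpc_state_eq mpc_control_eq[OF assms] mpc_input_def)

text \<open>A geometric series with ratio above the spectral radius of \<open>transpose F\<close>;
  the bound is uniform in the lookahead \<open>k\<close>.\<close>

lemma costate_bound:
  "\<exists>c>0. \<forall>w W k. (\<forall>i. norm (w i) \<le> W) \<longrightarrow> norm (costate w k) \<le> c * W"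
proof -
  define r where "r = (1 + spectral_radius F) / 2"
  have r: "spectral_radius (transpose F) < r" "0 < r" "r < 1"
    using F_stable spectral_radius_nonneg[of F] by (auto simp: r_def spectral_radius_transpose)
  obtain C where C: "C > 0" "\<And>k x. norm (matrix_power (transpose F) k *v x) \<le> C * r ^ k * norm x"
    using matrix_power_bound[OF r(1)] by blast
  have "norm (costate w k) \<le> (C * (spectral_norm P + 1) / (1 - r)) * W"
    if W: "\<forall>i. norm (w i) \<le> W" for w :: "nat \<Rightarrow> real ^ 'n" and W k
  proof -
    have W0: "W \<ge> 0"
      using W norm_ge_zero order_trans by blast
    have "norm (P *v w i) \<le> (spectral_norm P + 1) * W" for i
      using spectral_norm_bound[of P "w i"] W[rule_format, of i] spectral_norm_nonneg[of P] W0
      by (smt (verit) mult_mono norm_ge_zero)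
    then have "norm (matrix_power (transpose F) i *v (P *v w i)) \<le>
        C * r ^ i * ((spectral_norm P + 1) * W)" for i
      using C(2)[of i "P *v w i"] C(1) r
      by (smt (verit) mult_left_mono mult_nonneg_nonneg zero_le_power)
    then have "norm (costate w k) \<le> (\<Sum>i<k. C * r ^ i * ((spectral_norm P + 1) * W))"
      unfolding costate_def by (intro sum_norm_le) auto
    also have "\<dots> = C * ((spectral_norm P + 1) * W) * (\<Sum>i<k. r ^ i)"
      by (simp add: sum_distrib_left mult_ac)
    also have "\<dots> \<le> C * ((spectral_norm P + 1) * W) * (1 / (1 - r))"
      using r C(1) W0 spectral_norm_nonneg[of P]
      by (intro mult_left_mono geometric_sum_bound) auto
    finally show ?thesis
      by (simp add: mult_ac)
  qed
  moreover have "C * (spectral_norm P + 1) / (1 - r) > 0"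
    using r C(1) spectral_norm_nonneg[of P] by (simp add: add_nonneg_pos)
  ultimately show ?thesis
    by blast
qed

text \<open>Under the feedback the state obeys \<open>F\<close> with forcing
  \<open>w t - B *v (H *v q t)\<close>. Since \<open>q\<close> is arbitrary, one \<open>X\<close>
  serves MPC with every lookahead as well as the offline optimal policies.\<close>

lemma policy_bounded:
  assumes "0 \<le> b"
  shows "\<exists>X>0. \<forall>u w q. (\<forall>t. u t = opt_input (lin_state A B x0 u w t) (q t)) \<longrightarrow>
     (\<forall>t. norm (q t) \<le> b) \<longrightarrow> (\<forall>t. norm (w t) \<le> W) \<longrightarrow>
     (\<forall>t. norm (lin_state A B x0 u w t) \<le> X \<and> norm (u t) \<le> X)"
proof -
  interpret stable_matrix F
    by unfold_locales (rule F_stable)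
  obtain c where c: "c > 0" "\<And>x v V T t. \<forall>t<T. x (Suc t) = F *v x t + v t \<Longrightarrow>
      \<forall>t<T. norm (v t) \<le> V \<Longrightarrow> 0 \<le> V \<Longrightarrow> t \<le> T \<Longrightarrow> norm (x t) \<le> c * (norm (x 0) + V)"
    by (fact bounded_recursion)
  define nH where "nH = spectral_norm H"
  define V where "V = spectral_norm B * (nH * b) + W"
  define X where "X = \<bar>c * (norm x0 + V)\<bar>"
  define X' where "X' = X + nH * (spectral_norm (P ** A) * X + b) + 1"
  have "norm (lin_state A B x0 u w t) \<le> X' \<and> norm (u t) \<le> X'"
    if u: "\<forall>t. u t = opt_input (lin_state A B x0 u w t) (q t)"
      and q: "\<forall>t. norm (q t) \<le> b" and w: "\<forall>t. norm (w t) \<le> W" for u w q t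
  proof -
    have nonneg: "W \<ge> 0" "nH \<ge> 0"
      using w norm_ge_zero order_trans spectral_norm_nonneg unfolding nH_def by blast+
    define v where "v t = w t - B *v (H *v q t)" for t
    have Bo: "B *v opt_input x p = - (B *v (H *v (P *v (A *v x)))) - B *v (H *v p)" for x p
      by (simp add: opt_input_def vec.neg vec.diff matrix_vector_right_distrib)
    have step: "lin_state A B x0 u w (Suc t) = F *v lin_state A B x0 u w t + v t" for t
      using u[rule_format, of t] Bo[of "lin_state A B x0 u w t" "q t"]
      by (simp add: v_def F_apply)
    have "norm (B *v (H *v q t)) \<le> spectral_norm B * (nH * b)" for t
      unfolding nH_def using q by (intro spectral_norm_bound') simp
    then have "norm (v t) \<le> V" for t
      unfolding v_def V_def using w norm_triangle_ineq4[of "w t" "B *v (H *v q t)"]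
      by (smt (verit))
    moreover have "V \<ge> 0"
      using assms nonneg spectral_norm_nonneg[of B] by (simp add: V_def)
    ultimately have x: "norm (lin_state A B x0 u w t) \<le> X"
      using c(2)[of t "lin_state A B x0 u w" v V t] step by (simp add: X_def)
    have "norm ((P ** A) *v lin_state A B x0 u w t) \<le> spectral_norm (P ** A) * X"
      using x by (rule spectral_norm_bound')
    then have "norm (P *v (A *v lin_state A B x0 u w t) + q t) \<le> spectral_norm (P ** A) * X + b"
      using q[rule_format, of t] by (intro norm_triangle_le) (simp add: matrix_vector_mul_assoc)
    then have "norm (u t) \<le> nH * (spectral_norm (P ** A) * X + b)"
      using u[rule_format, of t] spectral_norm_bound' by (simp add: opt_input_def nH_def)
    then show ?thesis
      using x assms spectral_norm_nonneg[of "P ** A"] nonneg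
      by (smt (verit) X'_def norm_ge_zero)
  qed
  moreover have "X' > 0"
    using assms by (simp add: X'_def X_def nH_def spectral_norm_nonneg add_nonneg_pos)
  ultimately show ?thesis
    by blast
qed

end

section \<open>Comparing the costs\<close>

context riccati
begin

text \<open>Output injection: writing \<open>A\<close> as \<open>(A - L ** Q) + L ** Q\<close> makes
  the state the response of a stable matrix to \<open>Q *v x\<close>, \<open>u\<close> and
  \<open>w\<close>.\<close>

lemma detectable_state_sum:
  "\<exists>c>0. \<forall>u w x T. (\<Sum>t<T. norm (lin_state A B x u w t)) \<le>
     c * (norm x + (\<Sum>t<T. norm (Q *v lin_state A B x u w t) + norm (u t) + norm (w t)))"
proof -
  obtain L where L: "spectral_radius (A - L ** Q) < 1"
    by (rule detector)
  interpret stable_matrix "A - L ** Q"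
    by unfold_locales (rule L)
  obtain c where c: "c > 0" "\<And>x v T. \<forall>t<T. x (Suc t) = (A - L ** Q) *v x t + v t \<Longrightarrow>
      (\<Sum>t<T. norm (x t)) \<le> c * (norm (x 0) + (\<Sum>t<T. norm (v t)))"
    by (fact summable_recursion)
  define l where "l = spectral_norm L + spectral_norm B + 1"
  have l: "spectral_norm L \<le> l" "spectral_norm B \<le> l" "1 \<le> l"
    using spectral_norm_nonneg[of L] spectral_norm_nonneg[of B] by (simp_all add: l_def)
  have "(\<Sum>t<T. norm (lin_state A B x u w t)) \<le>
     c * l * (norm x + (\<Sum>t<T. norm (Q *v lin_state A B x u w t) + norm (u t) + norm (w t)))" for u w x T
  proof -
    define s where "s = lin_state A B x u w"
    define v where "v t = L *v (Q *v s t) + B *v u t + w t" for t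
    have "norm (v t) \<le> l * (norm (Q *v s t) + norm (u t) + norm (w t))" for t
    proof -
      have "norm (v t) \<le> norm (L *v (Q *v s t)) + norm (B *v u t) + norm (w t)"
        unfolding v_def by (intro norm_triangle_mono order_refl)
      also have "\<dots> \<le> l * norm (Q *v s t) + l * norm (u t) + l * norm (w t)"
        using l mult_right_mono[OF l(3), of "norm (w t)"]
        by (intro add_mono order_trans[OF spectral_norm_bound] mult_right_mono) auto
      finally show ?thesis
        by (simp add: algebra_simps)
    qed
    then have "(\<Sum>t<T. norm (v t)) \<le> l * (\<Sum>t<T. norm (Q *v s t) + norm (u t) + norm (w t))"
      by (simp add: sum_distrib_left sum_mono)
    moreover have "norm x \<le> l * norm x"
      using mult_right_mono[OF l(3), of "norm x"] by simp
    moreover have "(\<Sum>t<T. norm (s t)) \<le> c * (norm x + (\<Sum>t<T. norm (v t)))"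
      using c(2)[of T s v]
      by (simp add: s_def v_def matrix_vector_mult_diff_rdistrib matrix_vector_mul_assoc[symmetric])
    ultimately show ?thesis
      using c(1) unfolding s_def[symmetric]
      by (smt (verit) distrib_left mult.assoc mult_left_mono)
  qed
  moreover have "c * l > 0"
    using c(1) l by simp
  ultimately show ?thesis
    by blast
qed

lemma stage_cost_le:
  assumes "norm x \<le> X" "norm u \<le> X"
  shows "x \<bullet> (Q *v x) + u \<bullet> (R *v u) \<le> (spectral_norm Q + spectral_norm R) * X\<^sup>2"
  using quadratic_form_le'[OF assms(1), of Q] quadratic_form_le'[OF assms(2), of R]
  by (simp add: distrib_right)

lemma lq_cost_mono_horizon:
  assumes "s \<le> T"
  shows "lq_cost A B Q R 0 x s u w \<le> lq_cost A B Q R 0 x T u w"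
  unfolding lq_cost_def using assms form_nonneg
  by (auto intro!: sum_mono2 add_nonneg_nonneg)

lemma lq_cost_horizon_diff:
  assumes "s \<le> T" "\<And>t. norm (lin_state A B x u w t) \<le> X \<and> norm (u t) \<le> X"
  shows "lq_cost A B Q R 0 x T u w \<le>
    lq_cost A B Q R 0 x s u w + (spectral_norm Q + spectral_norm R) * X\<^sup>2 * real (T - s)"
proof -
  let ?f = "\<lambda>t. lin_state A B x u w t \<bullet> (Q *v lin_state A B x u w t) + u t \<bullet> (R *v u t)"
  have "(\<Sum>t\<in>{s..<T}. ?f t) \<le> real (card {s..<T}) * ((spectral_norm Q + spectral_norm R) * X\<^sup>2)"
    using assms(2) by (intro sum_bounded_above stage_cost_le) auto
  moreover have "(\<Sum>t<T. ?f t) = (\<Sum>t<s. ?f t) + (\<Sum>t\<in>{s..<T}. ?f t)"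
    using sum.atLeastLessThan_concat[of 0 s T ?f] assms(1) by (simp add: lessThan_atLeast0)
  ultimately show ?thesis
    by (simp add: lq_cost_def mult.commute)
qed

lemma lq_cost_nonneg:
  assumes "pos_semidef S"
  shows "0 \<le> lq_cost A B Q R S x T u w"
  unfolding lq_cost_def using assms form_nonneg
  by (auto intro!: add_nonneg_nonneg sum_nonneg simp: pos_semidef_def)

end

text \<open>\<open>X\<close> bounds the closed loop uniformly in the lookahead \<open>k\<close>; all constants below depend on
  \<open>k\<close>, the horizon and the disturbance only through it.\<close>

locale bounded_riccati = riccati A B Q P F R
  for A :: "real ^ 'n ^ 'n" and B :: "real ^ 'd ^ 'n" and Q P F :: "real ^ 'n ^ 'n"
    and R :: "real ^ 'd ^ 'd" +
  fixes Qf :: "real ^ 'n ^ 'n" and x0 :: "real ^ 'n" and W b X :: real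
  assumes Qf: "pos_semidef Qf"
    and W: "0 \<le> W"
    and b: "\<And>w k. (\<forall>i. norm (w i) \<le> W) \<Longrightarrow> norm (costate w k) \<le> b"
    and X: "\<And>u w q. (\<forall>t. u t = opt_input (lin_state A B x0 u w t) (q t)) \<Longrightarrow>
      (\<forall>t. norm (q t) \<le> b) \<Longrightarrow> (\<forall>t. norm (w t) \<le> W) \<Longrightarrow>
      (\<forall>t. norm (lin_state A B x0 u w t) \<le> X \<and> norm (u t) \<le> X)"
begin

abbreviation state where "state \<equiv> lin_state A B x0"
abbreviation cost where "cost S \<equiv> lq_cost A B Q R S x0"
abbreviation mpc where "mpc k \<equiv> mpc_input A B Q R P k x0"

definition stage_bound :: real where
  "stage_bound = (spectral_norm Q + spectral_norm R) * X\<^sup>2"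
definition final_bound :: real where
  "final_bound = (spectral_norm Qf + spectral_norm P) * X\<^sup>2"

lemma stage_bound_nonneg: "0 \<le> stage_bound" and final_bound_nonneg: "0 \<le> final_bound"
  by (simp_all add: stage_bound_def final_bound_def spectral_norm_nonneg)

lemma final_le:
  assumes "norm x \<le> X"
  shows "x \<bullet> (Qf *v x) \<le> final_bound" "x \<bullet> (P *v x) \<le> final_bound"
  using quadratic_form_le'[OF assms, of Qf] quadratic_form_le'[OF assms, of P]
    mult_nonneg_nonneg[OF spectral_norm_nonneg[of Qf] zero_le_power2[of X]]
    mult_nonneg_nonneg[OF spectral_norm_nonneg[of P] zero_le_power2[of X]]
  unfolding final_bound_def distrib_right by linarith+

lemma mpc_bounds:
  assumes "k \<ge> 1" "\<And>t. norm (w t) \<le> W"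
  shows "norm (state (mpc k w) w t) \<le> X \<and> norm (mpc k w t) \<le> X"
proof -
  have "norm (costate (\<lambda>i. w (t + i)) k) \<le> b" for t
    using assms(2) by (intro b) simp
  then show ?thesis
    using X[of "mpc k w" w "\<lambda>t. costate (\<lambda>i. w (t + i)) k"] mpc_input_eq[OF assms(1)] assms(2)
    by blast
qed

lemma mpc_near_optimal:
  assumes k: "k \<ge> 1" and w: "\<And>t. norm (w t) \<le> W" and tail: "\<And>t. t \<ge> T \<Longrightarrow> w t = 0"
  shows "cost P T (mpc k w) w \<le> opt_value T w x0 +
    real T * (spectral_norm G * (spectral_norm H * b)\<^sup>2 * (spectral_norm (matrix_power F k))\<^sup>2)"
proof -
  let ?d = "\<lambda>t. mpc k w t - opt_input (state (mpc k w) w t) (costate (\<lambda>i. w (t + i)) (T - t))"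
  let ?m = "spectral_norm H * (spectral_norm (matrix_power F k) * b)"
  have "norm (?d t) \<le> ?m" if t: "t < T" for t
  proof -
    let ?q = "costate (\<lambda>i. w (t + (k + i))) (T - t)"
    \<comment> \<open>Padding with \<open>k\<close> zero disturbances lets the first
      \<open>k\<close> terms be split off even when fewer than \<open>k\<close> steps
      remain.\<close>
    have "costate (\<lambda>i. w (t + i)) (T - t) = costate (\<lambda>i. w (t + i)) ((T - t) + k)"
      by (rule costate_zero_tail[symmetric]) (use t tail in simp)
    also have "\<dots> = costate (\<lambda>i. w (t + i)) k + matrix_power (transpose F) k *v ?q"
      by (subst add.commute) (simp add: costate_add)
    finally have "?d t = H *v (transpose (matrix_power F k) *v ?q)"
      by (subst mpc_input_eq[OF k])
         (simp add: opt_input_def matrix_vector_right_distrib transpose_matrix_power_commute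
           del: transpose_matrix_vector)
    also have "norm \<dots> \<le> spectral_norm H * norm (transpose (matrix_power F k) *v ?q)"
      by (rule spectral_norm_bound)
    also have "\<dots> \<le> spectral_norm H * (spectral_norm (matrix_power F k) * norm ?q)"
      by (intro mult_left_mono norm_transpose_mult_le spectral_norm_nonneg)
    also have "\<dots> \<le> ?m"
      using w by (intro mult_left_mono b spectral_norm_nonneg) simp
    finally show ?thesis .
  qed
  then have "(\<Sum>t<T. ?d t \<bullet> (G *v ?d t)) \<le> (\<Sum>t<T. spectral_norm G * ?m\<^sup>2)"
    by (intro sum_mono quadratic_form_le') simp
  then show ?thesis
    unfolding lq_cost_decomposition by (simp add: power_mult_distrib mult_ac)
qed

text \<open>At time \<open>t\<close> the controller plans \<open>t\<close> steps beyond the horizon,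
  but the disturbances there are zero and contribute nothing to the costate.\<close>

lemma mpc_full_optimal:
  assumes "T \<ge> 1" and tail: "\<And>t. t \<ge> T \<Longrightarrow> w t = 0"
  shows "cost P T (mpc T w) w = opt_value T w x0"
proof (rule lq_cost_optimal)
  fix t assume t: "t < T"
  have "costate (\<lambda>i. w (t + i)) ((T - t) + t) = costate (\<lambda>i. w (t + i)) (T - t)"
    by (rule costate_zero_tail) (use t tail in simp)
  then show "mpc T w t = opt_input (state (mpc T w) w t) (costate (\<lambda>i. w (t + i)) (T - t))"
    using t by (subst mpc_input_eq[OF assms(1)]) simp
qed

text \<open>The optimal policy for horizon \<open>s\<close> is continued up to \<open>T\<close>. For
  \<open>t \<ge> s\<close> the truncated difference \<open>s - t\<close> is 0, so it becomes pure
  linear feedback and stays within \<open>X\<close>.\<close>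

lemma opt_value_horizon_diff:
  assumes "s \<le> T" and w: "\<And>t. norm (w t) \<le> W"
  shows "opt_value T w x0 \<le> opt_value s w x0 + stage_bound * real (T - s) + final_bound"
proof -
  let ?q = "\<lambda>t. costate (\<lambda>i. w (t + i)) (s - t)"
  obtain u where u: "\<forall>t. u t = opt_input (state u w t) (?q t)"
    using feedback_realization[of "\<lambda>t y. opt_input y (?q t)"] by blast
  have "norm (?q t) \<le> b" for t
    using w by (intro b) simp
  then have bd: "norm (state u w t) \<le> X \<and> norm (u t) \<le> X" for t
    using X[of u w ?q] u w by blast
  have "opt_value T w x0 \<le> cost P T u w"
    by (rule opt_value_le)
  also have "\<dots> \<le> cost 0 T u w + final_bound"
    using final_le(2) bd by (subst lq_cost_terminal) simp
  also have "cost 0 T u w \<le> cost 0 s u w + stage_bound * real (T - s)"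
    unfolding stage_bound_def using assms(1) bd by (rule lq_cost_horizon_diff)
  also have "cost 0 s u w \<le> cost P s u w"
    using form_nonneg by (subst (2) lq_cost_terminal) simp
  also have "cost P s u w = opt_value s w x0"
    using u by (intro lq_cost_optimal) blast
  finally show ?thesis
    by simp
qed

lemma mpc_cost_bound:
  assumes "k \<ge> 1" and w: "\<And>t. norm (w t) \<le> W"
  shows "cost Qf T (mpc k w) w \<le> stage_bound * real T + final_bound"
proof -
  have "cost Qf T (mpc k w) w \<le> cost 0 T (mpc k w) w + final_bound"
    using final_le(1) mpc_bounds[OF assms] by (subst lq_cost_terminal) simp
  also have "cost 0 T (mpc k w) w \<le> cost 0 0 (mpc k w) w + stage_bound * real (T - 0)"
    unfolding stage_bound_def using mpc_bounds[OF assms] by (intro lq_cost_horizon_diff) auto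
  finally show ?thesis
    by (simp add: lq_cost_def)
qed

text \<open>Each of the two closed loops changes its terminal weight once, at a price of
  \<open>final_bound\<close>; in between, both are compared with the optimum for
  \<open>P\<close>.\<close>

lemma mpc_compare:
  assumes "k \<ge> 1" "T \<ge> 1" and w: "\<And>t. norm (w t) \<le> W" and tail: "\<And>t. t \<ge> T \<Longrightarrow> w t = 0"
  shows "cost Qf T (mpc k w) w \<le> cost Qf T (mpc T w) w + 2 * final_bound +
    real T * (spectral_norm G * (spectral_norm H * b)\<^sup>2 * (spectral_norm (matrix_power F k))\<^sup>2)"
proof -
  have x: "norm (state (mpc k w) w T) \<le> X" "norm (state (mpc T w) w T) \<le> X"
    using mpc_bounds w assms(1,2) by blast+
  have "cost Qf T (mpc k w) w \<le> cost P T (mpc k w) w + final_bound"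
    using final_le(1)[OF x(1)] form_nonneg(1)
    by (subst (1 2) lq_cost_terminal) (smt (verit))
  moreover have "cost P T (mpc T w) w \<le> cost Qf T (mpc T w) w + final_bound"
    using final_le(2)[OF x(2)] Qf[unfolded pos_semidef_def]
    by (subst (1 2) lq_cost_terminal) (smt (verit))
  moreover have "cost P T (mpc T w) w = opt_value T w x0"
    using assms(2) tail by (rule mpc_full_optimal)
  moreover note mpc_near_optimal[of k w T, OF assms(1) w tail]
  ultimately show ?thesis
    by linarith
qed

text \<open>The cost controls the squares of \<open>Q *v x\<close> and \<open>u\<close>, and
  \<open>y \<le> 1 + y\<^sup>2\<close> turns them into first powers, to which detectability applies.
  The cost hypothesis is the a priori bound of MPC.\<close>

lemma low_cost_small_state_sum:
  "\<exists>c>0. \<forall>T u w. (\<forall>t. norm (w t) \<le> W) \<longrightarrow> T \<ge> 1 \<longrightarrow>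
     cost Qf T u w \<le> stage_bound * real T + final_bound \<longrightarrow>
     (\<Sum>t<T. norm (state u w t)) \<le> c * real T"
proof -
  obtain c where c: "c > 0" "\<And>u w T. (\<Sum>t<T. norm (state u w t)) \<le>
      c * (norm x0 + (\<Sum>t<T. norm (Q *v state u w t) + norm (u t) + norm (w t)))"
    using detectable_state_sum by blast
  obtain c' where c': "c' \<ge> 0" "\<And>u. (norm u)\<^sup>2 \<le> c' * (u \<bullet> (R *v u))"
    using pos_def_norm_bound[OF R] by blast
  define m where "m = spectral_norm Q + c'"
  have m: "m \<ge> 0"
    using c' by (simp add: m_def spectral_norm_nonneg)
  have "(\<Sum>t<T. norm (state u w t)) \<le> c * (norm x0 + (2 + W) + m * (stage_bound + final_bound) + 1) * real T"
    if w: "\<forall>t. norm (w t) \<le> W" and T: "T \<ge> 1"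
      and le: "cost Qf T u w \<le> stage_bound * real T + final_bound" for T u w
  proof -
    have le_square: "y \<le> 1 + y\<^sup>2" for y :: real
      using zero_le_power2[of "y - 1/2"] by (simp add: power2_eq_square algebra_simps)
    have "norm (Q *v state u w t) + norm (u t) + norm (w t) \<le>
        (2 + W) + m * (state u w t \<bullet> (Q *v state u w t) + u t \<bullet> (R *v u t))" for t
    proof -
      have "(norm (Q *v state u w t))\<^sup>2 \<le> m * (state u w t \<bullet> (Q *v state u w t))"
        by (rule order_trans[OF pos_semidef_norm_mult[OF Q]])
           (intro mult_right_mono form_nonneg, simp add: m_def c')
      moreover have "(norm (u t))\<^sup>2 \<le> m * (u t \<bullet> (R *v u t))"
        by (rule order_trans[OF c'(2)])
           (intro mult_right_mono form_nonneg, simp add: m_def spectral_norm_nonneg)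
      ultimately show ?thesis
        using le_square[of "norm (Q *v state u w t)"] le_square[of "norm (u t)"] w[rule_format, of t]
        unfolding distrib_left by linarith
    qed
    then have "(\<Sum>t<T. norm (Q *v state u w t) + norm (u t) + norm (w t)) \<le>
        (\<Sum>t<T. (2 + W) + m * (state u w t \<bullet> (Q *v state u w t) + u t \<bullet> (R *v u t)))"
      by (intro sum_mono) auto
    also have "\<dots> = (2 + W) * real T + m * cost 0 T u w"
      by (simp add: sum.distrib lq_cost_def algebra_simps flip: sum_distrib_left)
    also have "cost 0 T u w \<le> cost Qf T u w"
      using Qf by (subst (2) lq_cost_terminal) (simp add: pos_semidef_def)
    also have "\<dots> \<le> (stage_bound + final_bound) * real T"
      using le T final_bound_nonneg mult_left_mono[of 1 "real T" final_bound]
      by (simp add: distrib_right)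
    finally have "norm x0 + (\<Sum>t<T. norm (Q *v state u w t) + norm (u t) + norm (w t)) \<le>
        norm x0 * real T + (2 + W) * real T + m * ((stage_bound + final_bound) * real T) + real T"
      using m T mult_left_mono[of 1 "real T" "norm x0"] by (simp add: mult_left_mono)
    also have "\<dots> = (norm x0 + (2 + W) + m * (stage_bound + final_bound) + 1) * real T"
      by (simp add: algebra_simps)
    finally show ?thesis
      using c(2)[where u = u and w = w and T = T] c(1)
      by (smt (verit) mult.assoc mult_left_mono)
  qed
  moreover have "c * (norm x0 + (2 + W) + m * (stage_bound + final_bound) + 1) > 0"
    using c(1) m W stage_bound_nonneg final_bound_nonneg
    by (intro mult_pos_pos add_nonneg_pos add_nonneg_nonneg mult_nonneg_nonneg) auto
  ultimately show ?thesis
    by blast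
qed

text \<open>A control sequence of cost \<open>O(T)\<close> visits a state of norm \<open>O(1/\<epsilon>)\<close> within the last \<open>\<epsilon>T\<close>
  steps, by detectability. Cutting it there and appending the terminal cost \<open>P\<close> compares it with the
  optimum for \<open>P\<close>, although the final state itself is not controlled when \<open>Qf\<close> is degenerate.\<close>

lemma mpc_asymptotically_optimal:
  assumes "0 < \<epsilon>" "\<epsilon> \<le> 1"
  shows "\<exists>C\<ge>0. \<forall>T u w. T \<ge> 1 \<longrightarrow> (\<forall>t. norm (w t) \<le> W) \<longrightarrow> (\<forall>t\<ge>T. w t = 0) \<longrightarrow>
    cost Qf T (mpc T w) w \<le> cost Qf T u w + stage_bound * \<epsilon> * real T + C"
proof -
  obtain c where c: "c > 0" "\<And>T u w. \<forall>t. norm (w t) \<le> W \<Longrightarrow> T \<ge> 1 \<Longrightarrow>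
     cost Qf T u w \<le> stage_bound * real T + final_bound \<Longrightarrow>
     (\<Sum>t<T. norm (state u w t)) \<le> c * real T"
    using low_cost_small_state_sum by blast
  define Y where "Y = spectral_norm P * (c / \<epsilon>)\<^sup>2"
  define C where "C = stage_bound + 2 * final_bound + Y"
  have C: "C \<ge> 0" and Y: "Y \<ge> 0"
    using stage_bound_nonneg final_bound_nonneg by (simp_all add: C_def Y_def spectral_norm_nonneg)
  have "cost Qf T (mpc T w) w \<le> cost Qf T u w + stage_bound * \<epsilon> * real T + C"
    if T: "T \<ge> 1" and w: "\<forall>t. norm (w t) \<le> W" and tail: "\<forall>t\<ge>T. w t = 0" for T u w
  proof (cases "cost Qf T u w \<le> stage_bound * real T + final_bound")
    \<comment> \<open>Such a competitor is already more expensive than the a priori bound on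
      MPC.\<close>
    case False
    moreover have "stage_bound * \<epsilon> * real T \<ge> 0"
      using stage_bound_nonneg assms by simp
    ultimately show ?thesis
      using mpc_cost_bound[OF T, of w T] w C by auto
  next
    case True
    define N where "N = nat \<lceil>\<epsilon> * real T\<rceil>"
    have "\<epsilon> * real T \<le> 1 * real T"
      using assms by (intro mult_right_mono) auto
    then have N: "N \<ge> 1" "N \<le> T" "\<epsilon> * real T \<le> real N" "real N \<le> \<epsilon> * real T + 1"
      using T assms unfolding N_def by (auto simp: nat_le_iff ceiling_le_iff Suc_le_eq)
    \<comment> \<open>Otherwise the last \<open>N\<close> states alone would sum to more than
      \<open>N * (c / \<epsilon>)\<close>, which is at least \<open>c * real T\<close>.\<close>
    have "\<exists>s\<in>{T - N..<T}. norm (state u w s) \<le> c / \<epsilon>"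
    proof (rule ccontr)
      assume "\<not> (\<exists>s\<in>{T - N..<T}. norm (state u w s) \<le> c / \<epsilon>)"
      then have far: "norm (state u w s) > c / \<epsilon>" if "s \<in> {T - N..<T}" for s
        using that by force
      have "c * real T \<le> real N * (c / \<epsilon>)"
        using N(3) assms c(1) by (simp add: field_simps)
      also have "\<dots> = (\<Sum>s\<in>{T - N..<T}. c / \<epsilon>)"
        using N by simp
      also have "\<dots> < (\<Sum>s\<in>{T - N..<T}. norm (state u w s))"
        using far N by (intro sum_strict_mono) auto
      also have "\<dots> \<le> (\<Sum>s<T. norm (state u w s))"
        by (intro sum_mono2) auto
      also have "\<dots> \<le> c * real T"
        using c(2) w T True by blast
      finally show False
        by simp
    qed
    then obtain s where s: "s \<in> {T - N..<T}" "norm (state u w s) \<le> c / \<epsilon>"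
      by blast
    have "norm (state (mpc T w) w T) \<le> X"
      using mpc_bounds T w by blast
    then have "cost Qf T (mpc T w) w \<le> cost P T (mpc T w) w + final_bound"
      using final_le(1) form_nonneg(1)
      by (subst (1 2) lq_cost_terminal) (smt (verit))
    also have "cost P T (mpc T w) w = opt_value T w x0"
      using T tail by (intro mpc_full_optimal) auto
    also have "opt_value T w x0 \<le> opt_value s w x0 + stage_bound * real (T - s) + final_bound"
      using s w by (intro opt_value_horizon_diff) auto
    also have "stage_bound * real (T - s) \<le> stage_bound * (\<epsilon> * real T + 1)"
    proof (rule mult_left_mono[OF _ stage_bound_nonneg])
      have "T - s \<le> N"
        using s(1) by auto
      then show "real (T - s) \<le> \<epsilon> * real T + 1"
        using N(4) by linarith
    qed
    also have "opt_value s w x0 \<le> cost P s u w"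
      by (rule opt_value_le)
    also have "cost P s u w \<le> cost 0 s u w + Y"
      unfolding Y_def using quadratic_form_le'[OF s(2), of P] by (subst lq_cost_terminal) simp
    also have "cost 0 s u w \<le> cost 0 T u w"
      using s(1) by (intro lq_cost_mono_horizon) auto
    also have "cost 0 T u w \<le> cost Qf T u w"
      using Qf by (subst (2) lq_cost_terminal) (simp add: pos_semidef_def)
    finally show ?thesis
      by (simp add: C_def algebra_simps)
  qed
  then show ?thesis
    using C by blast
qed

end

section \<open>The game value and the limits\<close>

text \<open>The bound may depend on \<open>u\<close> and \<open>T\<close>; it serves only to make
  the suprema over disturbances genuine.\<close>

lemma lq_cost_bounded:
  "\<exists>C. \<forall>w. (\<forall>i<T. norm (w i) \<le> W) \<longrightarrow> lq_cost A B Q R S x T u w \<le> C"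
proof -
  have "\<exists>X. \<forall>w. (\<forall>i<T. norm (w i) \<le> W) \<longrightarrow> t \<le> T \<longrightarrow> norm (lin_state A B x u w t) \<le> X" for t
  proof (induction t)
    case 0
    show ?case
      by auto
  next
    case (Suc t)
    then obtain X where X: "\<And>w. (\<forall>i<T. norm (w i) \<le> W) \<Longrightarrow> t \<le> T \<Longrightarrow>
        norm (lin_state A B x u w t) \<le> X"
      by blast
    have "norm (lin_state A B x u w (Suc t)) \<le> spectral_norm A * X + norm (B *v u t) + W"
      if "\<forall>i<T. norm (w i) \<le> W" "Suc t \<le> T" for w
      using that X[of w] by (simp add: norm_triangle_mono spectral_norm_bound')
    then show ?case
      by blast
  qed
  then obtain X where X: "\<And>t w. (\<forall>i<T. norm (w i) \<le> W) \<Longrightarrow> t \<le> T \<Longrightarrow>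
      norm (lin_state A B x u w t) \<le> X t"
    by metis
  have "lq_cost A B Q R S x T u w \<le>
      (\<Sum>t<T. spectral_norm Q * (X t)\<^sup>2 + u t \<bullet> (R *v u t)) + spectral_norm S * (X T)\<^sup>2"
    if "\<forall>i<T. norm (w i) \<le> W" for w
    unfolding lq_cost_def using that
    by (intro add_mono sum_mono quadratic_form_le' order_refl X) auto
  then show ?thesis
    by blast
qed

section \<open>Bounds and comparison for the game value\<close>

locale disturbance_game =
  fixes A :: "real ^ 'n ^ 'n" and B :: "real ^ 'd ^ 'n" and Q Qf :: "real ^ 'n ^ 'n"
    and R :: "real ^ 'd ^ 'd" and x0 :: "real ^ 'n" and \<Omega> :: "(real ^ 'n) set"
  assumes cost_nonneg: "\<And>T u w. 0 \<le> lq_cost A B Q R Qf x0 T u w"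
    and bounded_disturbances: "bounded \<Omega>" and nonempty: "\<Omega> \<noteq> {}"
begin

lemma cost_bounded: "\<exists>C. \<forall>w. (\<forall>i<T. w i \<in> \<Omega>) \<longrightarrow> lq_cost A B Q R Qf x0 T u w \<le> C"
proof -
  obtain W where "\<forall>z\<in>\<Omega>. norm z \<le> W"
    using bounded_disturbances by (auto simp: bounded_iff)
  then show ?thesis
    using lq_cost_bounded[of T W A B Q R Qf x0 u] by blast
qed

text \<open>Both bounds go through one induction, since infima need the lower and suprema the upper
  one.\<close>

lemma adv_value_bounds:
  assumes "t + k + m = T" "\<forall>i<t + k. w i \<in> \<Omega>"
  shows "0 \<le> adv_value A B Q R Qf x0 \<Omega> k T m t u w \<and>
    (\<forall>C. (\<forall>w. (\<forall>i<T. w i \<in> \<Omega>) \<longrightarrow> lq_cost A B Q R Qf x0 T u w \<le> C) \<longrightarrow>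
      adv_value A B Q R Qf x0 \<Omega> k T m t u w \<le> C)"
  using assms
proof (induction m arbitrary: t u w)
  case 0
  have "adv_value A B Q R Qf x0 \<Omega> k T 0 t u w \<le> lq_cost A B Q R Qf x0 T u w"
    unfolding adv_value.simps using cost_nonneg by (intro cINF_lower bdd_belowI2) auto
  moreover have "0 \<le> adv_value A B Q R Qf x0 \<Omega> k T 0 t u w"
    unfolding adv_value.simps using cost_nonneg by (intro cINF_greatest) auto
  ultimately show ?case
    using 0 by (auto intro: order_trans)
next
  case (Suc m)
  let ?a = "\<lambda>v z. adv_value A B Q R Qf x0 \<Omega> k T m (Suc t) (u(t := v)) (w(t + k := z))"
  have IH: "0 \<le> ?a v z" "\<forall>w. (\<forall>i<T. w i \<in> \<Omega>) \<longrightarrow> lq_cost A B Q R Qf x0 T (u(t := v)) w \<le> C \<Longrightarrow> ?a v z \<le> C"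
    if "z \<in> \<Omega>" for v z C
  proof -
    have "Suc t + k + m = T" "\<forall>i<Suc t + k. (w(t + k := z)) i \<in> \<Omega>"
      using Suc.prems that by (auto simp: less_Suc_eq)
    note Suc.IH[OF this, of "u(t := v)"]
    then show "0 \<le> ?a v z" "\<forall>w. (\<forall>i<T. w i \<in> \<Omega>) \<longrightarrow> lq_cost A B Q R Qf x0 T (u(t := v)) w \<le> C \<Longrightarrow> ?a v z \<le> C"
      by blast+
  qed
  have bdd: "bdd_above (?a v ` \<Omega>)" for v
  proof -
    obtain C where "\<forall>w. (\<forall>i<T. w i \<in> \<Omega>) \<longrightarrow> lq_cost A B Q R Qf x0 T (u(t := v)) w \<le> C"
      using cost_bounded by blast
    then show ?thesis
      using IH(2) by (intro bdd_aboveI2) blast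
  qed
  obtain z0 where z0: "z0 \<in> \<Omega>"
    using nonempty by blast
  have sup: "0 \<le> (SUP z\<in>\<Omega>. ?a v z)" for v
    using IH(1)[OF z0] by (rule cSUP_upper2[OF bdd z0])
  have "0 \<le> adv_value A B Q R Qf x0 \<Omega> k T (Suc m) t u w"
    unfolding adv_value.simps using sup by (intro cINF_greatest) auto
  moreover have "adv_value A B Q R Qf x0 \<Omega> k T (Suc m) t u w \<le> C"
    if C: "\<forall>w. (\<forall>i<T. w i \<in> \<Omega>) \<longrightarrow> lq_cost A B Q R Qf x0 T u w \<le> C" for C
  proof -
    \<comment> \<open>The minimizer may keep the control already recorded in \<open>u\<close>; the
      update is then trivial and the bound \<open>C\<close> passes down.\<close>
    have "(SUP z\<in>\<Omega>. ?a (u t) z) \<le> C"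
      using nonempty IH(2)[of _ "u t" C] C by (intro cSUP_least) auto
    then show ?thesis
      unfolding adv_value.simps using sup
      by (intro cINF_lower2[of _ _ "u t"] bdd_belowI2[of _ 0]) auto
  qed
  ultimately show ?case
    by blast
qed

lemma adv_value_bdd_above:
  assumes "t + k + m = T"
  shows "\<exists>C. \<forall>w. (\<forall>i<t + k. w i \<in> \<Omega>) \<longrightarrow> adv_value A B Q R Qf x0 \<Omega> k T m t u w \<le> C"
  using cost_bounded[of T u] adv_value_bounds[OF assms] by blast

text \<open>This is the minimax inequality: knowing all disturbances in advance can only help.\<close>

lemma adv_value_lower:
  assumes "t + k + m = T" "\<forall>i<T. w' i \<in> \<Omega>" "\<forall>i<t + k. w i = w' i"
    and "\<And>u'. (\<forall>i<t. u' i = u i) \<Longrightarrow> c \<le> lq_cost A B Q R Qf x0 T u' w'"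
  shows "c \<le> adv_value A B Q R Qf x0 \<Omega> k T m t u w"
  using assms
proof (induction m arbitrary: t u w)
  case 0
  have "lq_cost A B Q R Qf x0 T u' w = lq_cost A B Q R Qf x0 T u' w'" for u'
    using 0 by (intro lq_cost_cong) auto
  then show ?case
    unfolding adv_value.simps using 0 by (intro cINF_greatest) auto
next
  case (Suc m)
  let ?a = "\<lambda>v z. adv_value A B Q R Qf x0 \<Omega> k T m (Suc t) (u(t := v)) (w(t + k := z))"
  have "c \<le> (SUP z\<in>\<Omega>. ?a v z)" for v
  proof (rule cSUP_upper2)
    \<comment> \<open>The adversary commits to \<open>w'\<close> in advance, whatever the
      controls.\<close>
    show "w' (t + k) \<in> \<Omega>"
      using Suc.prems by simp
    show "c \<le> ?a v (w' (t + k))"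
    proof (rule Suc.IH)
      fix u' assume "\<forall>i<Suc t. u' i = (u(t := v)) i"
      then have "\<forall>i<t. u' i = u i"
        by (metis fun_upd_other less_SucI less_irrefl)
      then show "c \<le> lq_cost A B Q R Qf x0 T u' w'"
        by (rule Suc.prems(4))
    qed (use Suc.prems in \<open>auto simp: less_Suc_eq\<close>)
    obtain C where "\<forall>w. (\<forall>i<Suc t + k. w i \<in> \<Omega>) \<longrightarrow>
        adv_value A B Q R Qf x0 \<Omega> k T m (Suc t) (u(t := v)) w \<le> C"
      using adv_value_bdd_above[of "Suc t" k m T "u(t := v)"] Suc.prems(1) by auto
    moreover have "\<forall>i<Suc t + k. (w(t + k := z)) i \<in> \<Omega>" if "z \<in> \<Omega>" for z
      using that Suc.prems by (auto simp: less_Suc_eq)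
    ultimately show "bdd_above (?a v ` \<Omega>)"
      by (intro bdd_aboveI2[of _ _ C]) blast
  qed
  then show ?case
    unfolding adv_value.simps by (intro cINF_greatest) auto
qed

definition "offline w T = (INF u. lq_cost A B Q R Qf x0 T u w)"

lemma offline_le: "offline w T \<le> lq_cost A B Q R Qf x0 T u w"
  unfolding offline_def using cost_nonneg by (intro cINF_lower bdd_belowI2) auto

lemma adv_cost_full: "adv_cost A B Q R Qf x0 \<Omega> T T = (SUP w\<in>{w. \<forall>i<T. w i \<in> \<Omega>}. offline w T)"
  by (simp add: adv_cost_def offline_def)

lemma disturbances_nonempty: "{w. \<forall>i<T. w i \<in> \<Omega>} \<noteq> {}" for T :: nat
proof -
  obtain z where "z \<in> \<Omega>"
    using nonempty by blast
  then show ?thesis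
    by (auto intro!: exI[of _ "\<lambda>_. z"])
qed

lemma offline_le_adv_cost:
  assumes "\<forall>i<T. w i \<in> \<Omega>"
  shows "offline w T \<le> adv_cost A B Q R Qf x0 \<Omega> T T"
proof -
  obtain C where "\<forall>w. (\<forall>i<T. w i \<in> \<Omega>) \<longrightarrow> lq_cost A B Q R Qf x0 T (\<lambda>_. 0) w \<le> C"
    using cost_bounded by blast
  then have "bdd_above ((\<lambda>w. offline w T) ` {w. \<forall>i<T. w i \<in> \<Omega>})"
    by (intro bdd_aboveI2[of _ _ C]) (auto intro: order_trans[OF offline_le])
  then show ?thesis
    unfolding adv_cost_full using assms by (intro cSUP_upper) auto
qed

lemma adv_cost_mono:
  assumes "k \<le> T"
  shows "adv_cost A B Q R Qf x0 \<Omega> T T \<le> adv_cost A B Q R Qf x0 \<Omega> k T"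
  unfolding adv_cost_full
proof (rule cSUP_least[OF disturbances_nonempty], clarify)
  fix w assume w: "\<forall>i<T. w i \<in> \<Omega>"
  obtain C where "\<forall>w. (\<forall>i<k. w i \<in> \<Omega>) \<longrightarrow> adv_value A B Q R Qf x0 \<Omega> k T (T - k) 0 (\<lambda>_. 0) w \<le> C"
    using adv_value_bdd_above[of 0 k "T - k" T "\<lambda>_. 0"] assms by auto
  then have "bdd_above (adv_value A B Q R Qf x0 \<Omega> k T (T - k) 0 (\<lambda>_. 0) ` {w. \<forall>i<k. w i \<in> \<Omega>})"
    by (intro bdd_aboveI2[of _ _ C]) auto
  moreover have "offline w T \<le> adv_value A B Q R Qf x0 \<Omega> k T (T - k) 0 (\<lambda>_. 0) w"
    using w assms by (intro adv_value_lower[where w' = w] offline_le) auto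
  ultimately show "offline w T \<le> adv_cost A B Q R Qf x0 \<Omega> k T"
    unfolding adv_cost_def using w assms by (intro cSUP_upper2[of _ _ w]) auto
qed

end

section \<open>Worst-case costs of MPC against the offline optimum\<close>

locale mpc_game = bounded_riccati A B Q P F R Qf x0 W b X + disturbance_game A B Q Qf R x0 \<Omega>
  for A :: "real ^ 'n ^ 'n" and B :: "real ^ 'd ^ 'n" and Q P F :: "real ^ 'n ^ 'n"
    and R :: "real ^ 'd ^ 'd" and Qf :: "real ^ 'n ^ 'n" and x0 :: "real ^ 'n"
    and W b X :: real and \<Omega> :: "(real ^ 'n) set" +
  assumes disturbance_norm: "\<And>z. z \<in> \<Omega> \<Longrightarrow> norm z \<le> W"
begin

abbreviation cutoff :: "nat \<Rightarrow> (nat \<Rightarrow> real ^ 'n) \<Rightarrow> nat \<Rightarrow> real ^ 'n" where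
  "cutoff T w \<equiv> (\<lambda>s. if s < T then w s else 0)"

lemma mpc_cost_eq: "mpc_cost A B Q R Qf P x0 k T w = cost Qf T (mpc k (cutoff T w)) (cutoff T w)"
  by (simp add: mpc_cost_def Let_def)

lemma cutoff_cost: "cost Qf T u (cutoff T w) = cost Qf T u w"
  by (rule lq_cost_cong) auto

lemma cutoff_norm: "\<forall>i<T. w i \<in> \<Omega> \<Longrightarrow> norm (cutoff T w t) \<le> W"
  using disturbance_norm W by simp

lemma mpc_cost_le_adv_cost:
  assumes "k \<ge> 1" "\<forall>i<T. w i \<in> \<Omega>"
  shows "mpc_cost A B Q R Qf P x0 k T w \<le> mpc_adv_cost A B Q R Qf P x0 \<Omega> k T"
proof -
  have "bdd_above (mpc_cost A B Q R Qf P x0 k T ` {w. \<forall>i<T. w i \<in> \<Omega>})"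
    unfolding mpc_cost_eq using assms(1) cutoff_norm
    by (intro bdd_aboveI2[of _ _ "stage_bound * real T + final_bound"] mpc_cost_bound) auto
  then show ?thesis
    unfolding mpc_adv_cost_def using assms(2) by (intro cSUP_upper) auto
qed

lemma adv_cost_le_mpc:
  assumes "k \<ge> 1"
  shows "adv_cost A B Q R Qf x0 \<Omega> T T \<le> mpc_adv_cost A B Q R Qf P x0 \<Omega> k T"
  unfolding adv_cost_full
proof (rule cSUP_least[OF disturbances_nonempty], clarify)
  fix w assume w: "\<forall>i<T. w i \<in> \<Omega>"
  have "offline w T \<le> mpc_cost A B Q R Qf P x0 k T w"
    unfolding mpc_cost_eq cutoff_cost by (rule offline_le)
  then show "offline w T \<le> mpc_adv_cost A B Q R Qf P x0 \<Omega> k T"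
    using mpc_cost_le_adv_cost[OF assms w] by linarith
qed

text \<open>The constant is uniform in disturbance and competitor, so the infimum over controls can
  be taken before the supremum over disturbances.\<close>

lemma mpc_adv_cost_full_le:
  assumes "0 < \<epsilon>" "\<epsilon> \<le> 1"
  shows "\<exists>C. \<forall>T\<ge>1. mpc_adv_cost A B Q R Qf P x0 \<Omega> T T \<le>
    adv_cost A B Q R Qf x0 \<Omega> T T + stage_bound * \<epsilon> * real T + C"
proof -
  obtain C where C: "\<And>T u w. T \<ge> 1 \<Longrightarrow> (\<forall>t. norm (w t) \<le> W) \<Longrightarrow> (\<forall>t\<ge>T. w t = 0) \<Longrightarrow>
      cost Qf T (mpc T w) w \<le> cost Qf T u w + stage_bound * \<epsilon> * real T + C"
    using mpc_asymptotically_optimal[OF assms] by blast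
  have "mpc_cost A B Q R Qf P x0 T T w \<le> adv_cost A B Q R Qf x0 \<Omega> T T + stage_bound * \<epsilon> * real T + C"
    if T: "T \<ge> 1" and w: "\<forall>i<T. w i \<in> \<Omega>" for T w
  proof -
    have "mpc_cost A B Q R Qf P x0 T T w \<le> cost Qf T u w + stage_bound * \<epsilon> * real T + C" for u
      using C[of T "cutoff T w" u] T cutoff_norm[OF w] unfolding mpc_cost_eq cutoff_cost by auto
    then have "mpc_cost A B Q R Qf P x0 T T w - (stage_bound * \<epsilon> * real T + C) \<le> offline w T"
      unfolding offline_def by (intro cINF_greatest) (auto simp: algebra_simps)
    then show ?thesis
      using offline_le_adv_cost[OF w] by linarith
  qed
  then show ?thesis
    unfolding mpc_adv_cost_def by (intro exI[of _ C] allI impI cSUP_least disturbances_nonempty) auto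
qed

lemma mpc_adv_cost_le_full:
  assumes "k \<ge> 1" "T \<ge> 1"
  shows "mpc_adv_cost A B Q R Qf P x0 \<Omega> k T \<le> mpc_adv_cost A B Q R Qf P x0 \<Omega> T T +
    (spectral_norm G * (spectral_norm H * b)\<^sup>2 * (spectral_norm (matrix_power F k))\<^sup>2) * real T
      + 2 * final_bound"
  unfolding mpc_adv_cost_def[where k = k]
proof (rule cSUP_least[OF disturbances_nonempty], clarify)
  fix w assume w: "\<forall>i<T. w i \<in> \<Omega>"
  have "mpc_cost A B Q R Qf P x0 k T w \<le> mpc_cost A B Q R Qf P x0 T T w + 2 * final_bound +
      real T * (spectral_norm G * (spectral_norm H * b)\<^sup>2 * (spectral_norm (matrix_power F k))\<^sup>2)"
    unfolding mpc_cost_eq using assms cutoff_norm[OF w] by (intro mpc_compare) auto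
  then show "mpc_cost A B Q R Qf P x0 k T w \<le> mpc_adv_cost A B Q R Qf P x0 \<Omega> T T +
    (spectral_norm G * (spectral_norm H * b)\<^sup>2 * (spectral_norm (matrix_power F k))\<^sup>2) * real T
      + 2 * final_bound"
    using mpc_cost_le_adv_cost[OF assms(2) w] by (simp add: mult.commute)
qed

end

text \<open>The linear term contributes its slope and the constant disappears. The threshold
  \<open>N\<close> allows the inequality to fail on short horizons, such as
  \<open>T < k\<close>.\<close>

lemma average_limit_le:
  fixes f g :: "nat \<Rightarrow> real"
  assumes "(\<lambda>T. f T / real T) \<longlonglongrightarrow> a" "(\<lambda>T. g T / real T) \<longlonglongrightarrow> c"
    and le: "\<And>T. T \<ge> N \<Longrightarrow> f T \<le> g T + s * real T + C"
  shows "a \<le> c + s"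
proof (rule LIMSEQ_le[OF assms(1)])
  show "(\<lambda>T. g T / real T + s + C / real T) \<longlonglongrightarrow> c + s"
    using tendsto_add[OF tendsto_add[OF assms(2) tendsto_const[of s]] lim_const_over_n[of C]] by simp
  have "f T / real T \<le> g T / real T + s + C / real T" if "T \<ge> max N 1" for T
  proof -
    have "f T / real T \<le> (g T + s * real T + C) / real T"
      using that by (intro divide_right_mono le) auto
    also have "\<dots> = g T / real T + s + C / real T"
      using that by (simp add: add_divide_distrib)
    finally show ?thesis .
  qed
  then show "\<exists>N. \<forall>T\<ge>N. f T / real T \<le> g T / real T + s + C / real T"
    by blast
qed

text \<open>With no disturbance available, the supremum for \<open>T > 0\<close> is the unspecified
  constant \<open>Sup {}\<close>, whose average tends to 0. Hence \<open>ADV_inf > 0\<close> forces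
  \<open>\<Omega>\<close> to be nonempty.\<close>

lemma adv_cost_empty_limit: "(\<lambda>T. adv_cost A B Q R Qf x0 {} T T / real T) \<longlonglongrightarrow> 0"
proof -
  have "\<forall>\<^sub>F T in sequentially. Sup {} / real T = adv_cost A B Q R Qf x0 {} T T / real T"
    using eventually_gt_at_top[of 0]
    by eventually_elim (subst adv_cost_def, auto)
  then show ?thesis
    by (rule Lim_transform_eventually[rotated]) (rule lim_const_over_n)
qed

theorem corollary5p4:
  fixes A :: "real ^ 'n ^ 'n" and B :: "real ^ 'd ^ 'n"
    and Q Qf P F :: "real ^ 'n ^ 'n" and R :: "real ^ 'd ^ 'd"
    and x0 :: "real ^ 'n" and \<Omega> :: "(real ^ 'n) set"
    and lam :: real
    and ADV MPCA :: "nat \<Rightarrow> real" and ADV_inf MPCA_inf :: real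
  assumes "pos_semidef Q" and "pos_semidef Qf" and "pos_def R"
    and "stabilizable A B" and "detectable A Q"
    and "pos_semidef P"
    and "P = Q + transpose A ** P ** A
              - transpose A ** P ** B ** matrix_inv (R + transpose B ** P ** B)
                  ** transpose B ** P ** A"
    and "F = A - B ** matrix_inv (R + transpose B ** P ** B) ** transpose B ** P ** A"
    and "lam = (1 + spectral_radius F) / 2"
    and "bounded \<Omega>"
    and "\<And>k. k \<ge> 1 \<Longrightarrow> (\<lambda>T. adv_cost A B Q R Qf x0 \<Omega> k T / real T) \<longlonglongrightarrow> ADV k"
    and "(\<lambda>T. adv_cost A B Q R Qf x0 \<Omega> T T / real T) \<longlonglongrightarrow> ADV_inf"
    and "\<And>k. k \<ge> 1 \<Longrightarrow> (\<lambda>T. mpc_adv_cost A B Q R Qf P x0 \<Omega> k T / real T) \<longlonglongrightarrow> MPCA k"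
    and "(\<lambda>T. mpc_adv_cost A B Q R Qf P x0 \<Omega> T T / real T) \<longlonglongrightarrow> MPCA_inf"
    and "ADV_inf > 0"
  shows "(\<forall>k\<ge>1. MPCA k / ADV k \<le> MPCA k / ADV_inf \<and> MPCA k / ADV_inf = MPCA k / MPCA_inf)
    \<and> (\<lambda>k. MPCA k / MPCA_inf - 1) \<in> big_O (\<lambda>k. (spectral_norm (matrix_power F k))\<^sup>2)
    \<and> big_O (\<lambda>k. (spectral_norm (matrix_power F k))\<^sup>2) \<subseteq> big_O (\<lambda>k. lam ^ (2 * k))
    \<and> (\<lambda>k. MPCA k / MPCA_inf - 1) \<in> big_O (\<lambda>k. lam ^ (2 * k))"
proof -
  note ADV_lim = assms(11) and ADV_inf_lim = assms(12) and MPCA_lim = assms(13)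
    and MPCA_inf_lim = assms(14)
  interpret riccati A B Q P F R
    using assms(1,3,5-8) by unfold_locales
  have "\<Omega> \<noteq> {}"
    using LIMSEQ_unique[OF ADV_inf_lim] adv_cost_empty_limit assms(15) by fastforce
  obtain W where W: "W > 0" "\<And>z. z \<in> \<Omega> \<Longrightarrow> norm z \<le> W"
    using assms(10) bounded_pos by blast
  obtain c where c: "c > 0" "\<And>w k. \<forall>i. norm (w i) \<le> W \<Longrightarrow> norm (costate w k) \<le> c * W"
    using costate_bound by blast
  obtain X where X: "\<forall>u w q. (\<forall>t. u t = opt_input (lin_state A B x0 u w t) (q t)) \<longrightarrow>
     (\<forall>t. norm (q t) \<le> c * W) \<longrightarrow> (\<forall>t. norm (w t) \<le> W) \<longrightarrow>
     (\<forall>t. norm (lin_state A B x0 u w t) \<le> X \<and> norm (u t) \<le> X)"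
    using policy_bounded[of "c * W" x0 W] c(1) W(1) by auto
  interpret mpc_game A B Q P F R Qf x0 W "c * W" X \<Omega>
    using assms(2,10) W c(2) X \<open>\<Omega> \<noteq> {}\<close> lq_cost_nonneg[OF assms(2)]
    by unfold_locales (blast | simp)+
  define \<Gamma> where "\<Gamma> = spectral_norm G * (spectral_norm H * (c * W))\<^sup>2"
  have \<Gamma>: "\<Gamma> \<ge> 0"
    by (simp add: \<Gamma>_def spectral_norm_nonneg)
  have ADV_ge: "ADV_inf \<le> ADV k" if "k \<ge> 1" for k
    using average_limit_le[OF ADV_inf_lim ADV_lim[OF that], of k 0 0] adv_cost_mono by simp
  have MPCA_ge: "ADV_inf \<le> MPCA k" if "k \<ge> 1" for k
    using average_limit_le[OF ADV_inf_lim MPCA_lim[OF that], of 0 0 0] adv_cost_le_mpc[OF that]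
    by simp
  have "ADV_inf \<le> MPCA_inf"
    using average_limit_le[OF ADV_inf_lim MPCA_inf_lim, of 1 0 0] adv_cost_le_mpc by simp
  moreover have "MPCA_inf \<le> ADV_inf"
  proof (rule ccontr)
    assume "\<not> MPCA_inf \<le> ADV_inf"
    \<comment> \<open>Chosen so that \<open>stage_bound * \<epsilon>\<close> is less than half of
      the supposed gap; the 1 in the denominator covers \<open>stage_bound = 0\<close>.\<close>
    define \<epsilon> where "\<epsilon> = min 1 ((MPCA_inf - ADV_inf) / (2 * (stage_bound + 1)))"
    have \<epsilon>: "0 < \<epsilon>" "\<epsilon> \<le> 1"
      using \<open>\<not> MPCA_inf \<le> ADV_inf\<close> stage_bound_nonneg by (simp_all add: \<epsilon>_def)
    obtain C where "\<And>T. T \<ge> 1 \<Longrightarrow> mpc_adv_cost A B Q R Qf P x0 \<Omega> T T \<le>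
        adv_cost A B Q R Qf x0 \<Omega> T T + stage_bound * \<epsilon> * real T + C"
      using mpc_adv_cost_full_le[OF \<epsilon>] by blast
    then have "MPCA_inf \<le> ADV_inf + stage_bound * \<epsilon>"
      by (rule average_limit_le[OF MPCA_inf_lim ADV_inf_lim])
    moreover have "\<epsilon> * (2 * (stage_bound + 1)) \<le> MPCA_inf - ADV_inf"
      using stage_bound_nonneg by (subst pos_le_divide_eq[symmetric]) (auto simp: \<epsilon>_def)
    ultimately show False
      using \<open>\<not> MPCA_inf \<le> ADV_inf\<close> \<epsilon>(1) by (simp add: algebra_simps)
  qed
  ultimately have eq: "MPCA_inf = ADV_inf"
    by simp
  have MPCA_le: "MPCA k \<le> MPCA_inf + \<Gamma> * (spectral_norm (matrix_power F k))\<^sup>2" if "k \<ge> 1" for k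
    unfolding \<Gamma>_def
    by (rule average_limit_le[OF MPCA_lim[OF that] MPCA_inf_lim mpc_adv_cost_le_full[OF that]])
  have "MPCA k / ADV k \<le> MPCA k / ADV_inf" if "k \<ge> 1" for k
    using ADV_ge[OF that] MPCA_ge[OF that] assms(15) by (intro divide_left_mono) auto
  moreover have "(\<lambda>k. MPCA k / MPCA_inf - 1) \<in> big_O (\<lambda>k. (spectral_norm (matrix_power F k))\<^sup>2)"
  proof -
    \<comment> \<open>The added 1 keeps the constant positive, as \<open>big_O\<close> demands, when
      \<open>\<Gamma> = 0\<close>.\<close>
    have "\<bar>MPCA k / MPCA_inf - 1\<bar> \<le> (\<Gamma> / MPCA_inf + 1) * (spectral_norm (matrix_power F k))\<^sup>2"
      if "k \<ge> 1" for k
    proof -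
      have "\<bar>MPCA k / MPCA_inf - 1\<bar> = (MPCA k - MPCA_inf) / MPCA_inf"
        using MPCA_ge[OF that] assms(15) eq by (simp add: field_simps)
      also have "\<dots> \<le> (\<Gamma> * (spectral_norm (matrix_power F k))\<^sup>2) / MPCA_inf"
        using MPCA_le[OF that] assms(15) eq by (intro divide_right_mono) auto
      also have "\<dots> \<le> (\<Gamma> / MPCA_inf + 1) * (spectral_norm (matrix_power F k))\<^sup>2"
        by (simp add: distrib_right)
      finally show ?thesis .
    qed
    moreover have "\<Gamma> / MPCA_inf + 1 > 0"
      using \<Gamma> assms(15) eq by (simp add: add_nonneg_pos)
    ultimately show ?thesis
      by (auto simp: big_O_def)
  qed
  moreover have "big_O (\<lambda>k. (spectral_norm (matrix_power F k))\<^sup>2) \<subseteq> big_O (\<lambda>k. lam ^ (2 * k))"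
  proof
    fix f assume "f \<in> big_O (\<lambda>k. (spectral_norm (matrix_power F k))\<^sup>2)"
    then obtain D where D: "D > 0" "\<And>k. k \<ge> 1 \<Longrightarrow> \<bar>f k\<bar> \<le> D * (spectral_norm (matrix_power F k))\<^sup>2"
      by (auto simp: big_O_def)
    have lam: "spectral_radius F < lam"
      using F_stable assms(9) by simp
    obtain C where C: "C > 0" "\<And>k x. norm (matrix_power F k *v x) \<le> C * lam ^ k * norm x"
      using matrix_power_bound[OF lam] by blast
    have "spectral_norm (matrix_power F k) \<le> C * lam ^ k" for k
      unfolding spectral_norm_def by (rule onorm_le) (rule C(2))
    then have "(spectral_norm (matrix_power F k))\<^sup>2 \<le> C\<^sup>2 * lam ^ (2 * k)" for k
      by (metis power_mono spectral_norm_nonneg power_mult_distrib power_even_eq)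
    then have "\<bar>f k\<bar> \<le> D * C\<^sup>2 * lam ^ (2 * k)" if "k \<ge> 1" for k
      using D(2)[OF that] D(1) by (smt (verit) mult.assoc mult_left_mono)
    moreover have "D * C\<^sup>2 > 0"
      using C(1) D(1) by simp
    ultimately show "f \<in> big_O (\<lambda>k. lam ^ (2 * k))"
      unfolding big_O_def by blast
  qed
  ultimately show ?thesis
    using eq by blast
qed

end
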